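(* Let $D$ be an integral domain with quotient field $K$, and let $\iota:\mathrm{Overr}(D)\to \mathrm{SStar}_f(D)$ be the map $\iota(T):=\wedge_{\{T\}}$, where $E^{\wedge_{\{T\}}}:=ET$ for every nonzero $D$-submodule $E$ of $K$. If $T\in\mathrm{Overr}(D)$, then the semistar operation $\iota(T)$ is stable if and only if $T$ is flat over $D$.
   Context: Let $D$ be an integral domain with quotient field $K$; $\overline{\mathbf F}(D)$ is the set of nonzero $D$-submodules of $K$, and $\mathbf f(D)$ is the set of nonzero finitely generated fractional ideals of $D$. $\mathrm{Overr}(D)$ is the set of overrings of $D$, i.e. rings $T$ with $D\subseteq T\subseteq K$. A semistar operation on $D$ is a map $\star:\overline{\mathbf F}(D)\to\overline{\mathbf F}(D)$, $E\mapsto E^\star$, such that for all $0\ne z\in K$ and $E,F\in\overline{\mathbf F}(D)$: $(zE)^\star=zE^\star$; $E\subseteq F\Rightarrow E^\star\subseteq F^\star$; $E\subseteq E^\star$; $(E^\star)^\star=E^\star$. It is of finite type if $E^\star=\bigcup\{F^\star\mid F\subseteq E,\ F\in\mathbf f(D)\}$ for all $E\in\overline{\mathbf F}(D)$; $\mathrm{SStar}_f(D)$ is the set of semistar operations of finite type. It is stable if $(E\cap H)^\star=E^\star\cap H^\star$ for all $E,H\in\overline{\mathbf F}(D)$. *)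

theory Defs
  imports "HOL-Algebra.Algebra"
begin

section \<open>Submodules of a quotient field and semistar operations\<close>

definition quotient_field :: "'a set \<Rightarrow> ('a, 'b) ring_scheme \<Rightarrow> bool" where
  "quotient_field D K \<longleftrightarrow> field K \<and> subdomain D K \<and>
     (\<forall>x \<in> carrier K. \<exists>a \<in> D. \<exists>b \<in> D - {\<zero>\<^bsub>K\<^esub>}. x = a \<otimes>\<^bsub>K\<^esub> inv\<^bsub>K\<^esub> b)"

definition as_module :: "('a, 'b) ring_scheme \<Rightarrow> 'a set \<Rightarrow> ('a, 'a) module" where
  "as_module K S = \<lparr>carrier = S, monoid.mult = monoid.mult K, one = \<one>\<^bsub>K\<^esub>,
     ring.zero = \<zero>\<^bsub>K\<^esub>, add = add K, smult = monoid.mult K\<rparr>"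

abbreviation is_submodule :: "'a set \<Rightarrow> ('a, 'b) ring_scheme \<Rightarrow> 'a set \<Rightarrow> bool" where
  "is_submodule D K E \<equiv> submodule E (K\<lparr>carrier := D\<rparr>) (as_module K (carrier K))"

definition Fbar :: "'a set \<Rightarrow> ('a, 'b) ring_scheme \<Rightarrow> 'a set set" where
  "Fbar D K = {E. is_submodule D K E \<and> E \<noteq> {\<zero>\<^bsub>K\<^esub>}}"

definition fg_fractional :: "'a set \<Rightarrow> ('a, 'b) ring_scheme \<Rightarrow> 'a set set" where
  "fg_fractional D K = {F \<in> Fbar D K.
     (\<exists>d \<in> D - {\<zero>\<^bsub>K\<^esub>}. \<forall>x \<in> F. d \<otimes>\<^bsub>K\<^esub> x \<in> D) \<and>
     (\<exists>S. finite S \<and> S \<subseteq> carrier K \<and> F = is_submodule D K hull S)}"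

definition Overr :: "'a set \<Rightarrow> ('a, 'b) ring_scheme \<Rightarrow> 'a set set" where
  "Overr D K = {T. subring T K \<and> D \<subseteq> T}"

definition semistar :: "'a set \<Rightarrow> ('a, 'b) ring_scheme \<Rightarrow> ('a set \<Rightarrow> 'a set) set" where
  "semistar D K = {s \<in> Fbar D K \<rightarrow>\<^sub>E Fbar D K.
     (\<forall>z \<in> carrier K - {\<zero>\<^bsub>K\<^esub>}. \<forall>E \<in> Fbar D K. s (z <#\<^bsub>K\<^esub> E) = z <#\<^bsub>K\<^esub> s E) \<and>
     (\<forall>E \<in> Fbar D K. \<forall>F \<in> Fbar D K. E \<subseteq> F \<longrightarrow> s E \<subseteq> s F) \<and>
     (\<forall>E \<in> Fbar D K. E \<subseteq> s E) \<and>
     (\<forall>E \<in> Fbar D K. s (s E) = s E)}"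

definition SStar_f :: "'a set \<Rightarrow> ('a, 'b) ring_scheme \<Rightarrow> ('a set \<Rightarrow> 'a set) set" where
  "SStar_f D K = {s \<in> semistar D K.
     \<forall>E \<in> Fbar D K. s E = \<Union> {s F | F. F \<subseteq> E \<and> F \<in> fg_fractional D K}}"

definition stable :: "'a set \<Rightarrow> ('a, 'b) ring_scheme \<Rightarrow> ('a set \<Rightarrow> 'a set) \<Rightarrow> bool" where
  "stable D K s \<longleftrightarrow> (\<forall>E \<in> Fbar D K. \<forall>H \<in> Fbar D K. s (E \<inter> H) = s E \<inter> s H)"

text \<open>The library's \<^const>\<open>ideal_prod\<close> makes sense for arbitrary subsets \<open>E\<close>, \<open>T\<close> of a ring: it is
  the set of all nonempty finite sums of products \<open>e t\<close>, so for submodules it is \<open>E T\<close>.\<close>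

definition \<iota> :: "'a set \<Rightarrow> ('a, 'b) ring_scheme \<Rightarrow> 'a set \<Rightarrow> ('a set \<Rightarrow> 'a set)" where
  "\<iota> D K = (\<lambda>T \<in> Overr D K. \<lambda>E \<in> Fbar D K. ideal_prod K E T)"


section \<open>Tensor products and flatness\<close>

definition module_hom ::
  "('r, 's) ring_scheme \<Rightarrow> ('r, 'n, 't) module_scheme \<Rightarrow> ('r, 'k, 'u) module_scheme \<Rightarrow> ('n \<Rightarrow> 'k) set" where
  "module_hom R N N' = {f \<in> carrier N \<rightarrow> carrier N'.
     (\<forall>x \<in> carrier N. \<forall>y \<in> carrier N. f (x \<oplus>\<^bsub>N\<^esub> y) = f x \<oplus>\<^bsub>N'\<^esub> f y) \<and>
     (\<forall>r \<in> carrier R. \<forall>x \<in> carrier N. f (r \<odot>\<^bsub>N\<^esub> x) = r \<odot>\<^bsub>N'\<^esub> f x)}"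

text \<open>Over a commutative ring \<open>R\<close> the additive group of \<open>M \<otimes>\<^sub>R N\<close> is the free abelian group on
  \<open>M \<times> N\<close> modulo the following relations.  The scalar multiplication on it is not needed below,
  since flatness only concerns injectivity of induced maps.\<close>

definition tensor_rels ::
  "('r, 's) ring_scheme \<Rightarrow> ('r, 'm, 't) module_scheme \<Rightarrow> ('r, 'n, 'u) module_scheme \<Rightarrow>
   ('m \<times> 'n \<Rightarrow>\<^sub>0 int) set" where
  "tensor_rels R M N =
     {frag_of (x \<oplus>\<^bsub>M\<^esub> y, n) - frag_of (x, n) - frag_of (y, n) | x y n.
        x \<in> carrier M \<and> y \<in> carrier M \<and> n \<in> carrier N} \<union>
     {frag_of (x, n \<oplus>\<^bsub>N\<^esub> p) - frag_of (x, n) - frag_of (x, p) | x n p.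
        x \<in> carrier M \<and> n \<in> carrier N \<and> p \<in> carrier N} \<union>
     {frag_of (r \<odot>\<^bsub>M\<^esub> x, n) - frag_of (x, r \<odot>\<^bsub>N\<^esub> n) | r x n.
        r \<in> carrier R \<and> x \<in> carrier M \<and> n \<in> carrier N}"

abbreviation tensor_free ::
  "('r, 'm, 't) module_scheme \<Rightarrow> ('r, 'n, 'u) module_scheme \<Rightarrow> ('m \<times> 'n \<Rightarrow>\<^sub>0 int) monoid" where
  "tensor_free M N \<equiv> free_Abelian_group (carrier M \<times> carrier N)"

definition tensor_ker ::
  "('r, 's) ring_scheme \<Rightarrow> ('r, 'm, 't) module_scheme \<Rightarrow> ('r, 'n, 'u) module_scheme \<Rightarrow>
   ('m \<times> 'n \<Rightarrow>\<^sub>0 int) set" where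
  "tensor_ker R M N = generate (tensor_free M N) (tensor_rels R M N)"

definition tensor ::
  "('r, 's) ring_scheme \<Rightarrow> ('r, 'm, 't) module_scheme \<Rightarrow> ('r, 'n, 'u) module_scheme \<Rightarrow>
   ('m \<times> 'n \<Rightarrow>\<^sub>0 int) set monoid" where
  "tensor R M N = tensor_free M N Mod tensor_ker R M N"

text \<open>The map \<open>id \<otimes> f\<close> from \<open>M \<otimes>\<^sub>R N\<close> to \<open>M \<otimes>\<^sub>R N'\<close>, sending the class of \<open>\<Sum> (m\<^sub>i, n\<^sub>i)\<close> to the class
  of \<open>\<Sum> (m\<^sub>i, f n\<^sub>i)\<close>.  The union is over cosets that all coincide, see \<open>tensor_map_coset\<close>.\<close>

definition tensor_map ::
  "('r, 's) ring_scheme \<Rightarrow> ('r, 'm, 't) module_scheme \<Rightarrow> ('r, 'k, 'u) module_scheme \<Rightarrow> ('n \<Rightarrow> 'k) \<Rightarrow>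
   ('m \<times> 'n \<Rightarrow>\<^sub>0 int) set \<Rightarrow> ('m \<times> 'k \<Rightarrow>\<^sub>0 int) set" where
  "tensor_map R M N' f A =
     (\<Union>c \<in> A. tensor_ker R M N' #>\<^bsub>tensor_free M N'\<^esub> frag_extend (\<lambda>(m, n). frag_of (m, f n)) c)"

text \<open>\<open>M\<close> is flat if \<open>M \<otimes>\<^sub>R _\<close> preserves injectivity of linear maps.  A definition in HOL cannot
  quantify over types, so the type \<open>'n\<close> of the elements of the test modules \<open>N\<close>, \<open>N'\<close> is a
  parameter.  Over a type that is too small (such as \<^typ>\<open>unit\<close>) every module would be flat.
  At \<open>'n = 'r + 'u\<close> with \<open>'u\<close> arbitrary, the test modules comprise, up to isomorphism, every
  \<open>R\<close>-module with elements in \<open>'u\<close> (via \<^const>\<open>Inr\<close>) and every ideal of \<open>R\<close> (via \<^const>\<open>Inl\<close>).\<close>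

definition flat ::
  "'n itself \<Rightarrow> ('r, 's) ring_scheme \<Rightarrow> ('r, 'm, 't) module_scheme \<Rightarrow> bool" where
  "flat U R M \<longleftrightarrow> module R M \<and>
     (\<forall>(N :: ('r, 'n) module) (N' :: ('r, 'n) module) f.
        module R N \<and> module R N' \<and> f \<in> module_hom R N N' \<and> inj_on f (carrier N) \<longrightarrow>
        inj_on (tensor_map R M N' f) (carrier (tensor R M N)))"


section \<open>Well-definedness\<close>

lemma tensor_rels_subset:
  assumes "module R M" "module R N"
  shows "tensor_rels R M N \<subseteq> carrier (tensor_free M N)"
proof -
  interpret M: module R M by fact
  interpret N: module R N by fact
  have k: "Poly_Mapping.keys (u - v) \<subseteq> S"
    if "Poly_Mapping.keys u \<subseteq> S" "Poly_Mapping.keys v \<subseteq> S" for u v :: "_ \<Rightarrow>\<^sub>0 int" and S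
    using that keys_diff[of u v] by blast
  show ?thesis
    unfolding tensor_rels_def
    by (intro Un_least subsetI; clarify; unfold carrier_free_Abelian_group_iff; intro k) auto
qed

lemma tensor_map_coset:
  assumes M: "module R M" and N: "module R N" and N': "module R N'"
    and f: "f \<in> module_hom R N N'" and c: "c \<in> carrier (tensor_free M N)"
  shows "tensor_map R M N' f (tensor_ker R M N #>\<^bsub>tensor_free M N\<^esub> c) =
         tensor_ker R M N' #>\<^bsub>tensor_free M N'\<^esub> frag_extend (\<lambda>(m, n). frag_of (m, f n)) c"
proof -
  interpret M: module R M by fact
  interpret N: module R N by fact
  interpret N': module R N' by fact
  let ?h = "frag_extend (\<lambda>(m, n). frag_of (m, f n)) :: _ \<Rightarrow> (_ \<times> _) \<Rightarrow>\<^sub>0 int"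
  let ?G = "tensor_free M N" and ?G' = "tensor_free M N'"
  interpret G: group ?G by simp
  interpret G': group ?G' by simp
  have sub: "subgroup (tensor_ker R M N) ?G"
    unfolding tensor_ker_def by (intro G.generate_is_subgroup tensor_rels_subset M N)
  have sub': "subgroup (tensor_ker R M N') ?G'"
    unfolding tensor_ker_def by (intro G'.generate_is_subgroup tensor_rels_subset M N')
  have fc: "f x \<in> carrier N'" if "x \<in> carrier N" for x using f that by (auto simp: module_hom_def)
  have hc: "?h x \<in> carrier ?G'" if "x \<in> carrier ?G" for x
  proof -
    have "Poly_Mapping.keys (?h x) \<subseteq> (\<Union>p \<in> Poly_Mapping.keys x. Poly_Mapping.keys (case p of (m, n) \<Rightarrow> frag_of (m, f n)))"
      by (rule keys_frag_extend)
    also have "\<dots> \<subseteq> carrier M \<times> carrier N'"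
    proof (rule UN_least)
      fix p assume "p \<in> Poly_Mapping.keys x"
      then have "fst p \<in> carrier M" "snd p \<in> carrier N" using that by auto
      then show "Poly_Mapping.keys (case p of (m, n) \<Rightarrow> frag_of (m, f n)) \<subseteq> carrier M \<times> carrier N'"
        using fc by (simp add: case_prod_beta)
    qed
    finally show ?thesis by simp
  qed
  have h: "?h \<in> hom ?G ?G'" by (rule homI) (auto simp: hc[simplified] frag_extend_add)
  have rels: "?h ` tensor_rels R M N \<subseteq> tensor_rels R M N'"
  proof
    fix y assume "y \<in> ?h ` tensor_rels R M N"
    then obtain x where x: "x \<in> tensor_rels R M N" and y: "y = ?h x" by blast
    from x[unfolded tensor_rels_def] show "y \<in> tensor_rels R M N'"
    proof (elim UnE CollectE exE conjE)
      fix a b n assume *: "x = frag_of (a \<oplus>\<^bsub>M\<^esub> b, n) - frag_of (a, n) - frag_of (b, n)"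
        "a \<in> carrier M" "b \<in> carrier M" "n \<in> carrier N"
      have "y = frag_of (a \<oplus>\<^bsub>M\<^esub> b, f n) - frag_of (a, f n) - frag_of (b, f n)"
        unfolding y * by (simp add: frag_extend_diff)
      with * fc show "y \<in> tensor_rels R M N'" unfolding tensor_rels_def by blast
    next
      fix a n p assume *: "x = frag_of (a, n \<oplus>\<^bsub>N\<^esub> p) - frag_of (a, n) - frag_of (a, p)"
        "a \<in> carrier M" "n \<in> carrier N" "p \<in> carrier N"
      have "y = frag_of (a, f n \<oplus>\<^bsub>N'\<^esub> f p) - frag_of (a, f n) - frag_of (a, f p)"
        unfolding y * using f * by (simp add: frag_extend_diff module_hom_def)
      with * fc show "y \<in> tensor_rels R M N'" unfolding tensor_rels_def by blast
    next
      fix r a n assume *: "x = frag_of (r \<odot>\<^bsub>M\<^esub> a, n) - frag_of (a, r \<odot>\<^bsub>N\<^esub> n)"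
        "r \<in> carrier R" "a \<in> carrier M" "n \<in> carrier N"
      have "y = frag_of (r \<odot>\<^bsub>M\<^esub> a, f n) - frag_of (a, r \<odot>\<^bsub>N'\<^esub> f n)"
        unfolding y * using f * by (simp add: frag_extend_diff module_hom_def)
      with * fc show "y \<in> tensor_rels R M N'" unfolding tensor_rels_def by blast
    qed
  qed
  interpret h: group_hom ?G ?G' ?h
    by (intro group_hom.intro group_hom_axioms.intro h G.group_axioms G'.group_axioms)
  have "?h ` tensor_ker R M N = generate ?G' (?h ` tensor_rels R M N)"
    unfolding tensor_ker_def by (intro h.generate_img[symmetric] tensor_rels_subset M N)
  also have "\<dots> \<subseteq> tensor_ker R M N'"
    unfolding tensor_ker_def by (rule G'.mono_generate[OF rels])
  finally have ker: "?h ` tensor_ker R M N \<subseteq> tensor_ker R M N'" .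
  have same: "tensor_ker R M N' #>\<^bsub>?G'\<^esub> ?h d = tensor_ker R M N' #>\<^bsub>?G'\<^esub> ?h c"
    if "d \<in> tensor_ker R M N #>\<^bsub>?G\<^esub> c" for d
  proof -
    from that obtain k where k: "k \<in> tensor_ker R M N" "d = k + c"
      by (auto simp: r_coset_def)
    have "?h d = ?h k + ?h c" by (simp add: k frag_extend_add)
    then have "?h d \<in> tensor_ker R M N' #>\<^bsub>?G'\<^esub> ?h c"
      using ker k by (auto simp: r_coset_def)
    then show ?thesis using G'.repr_independence[OF _ hc[OF c] sub'] by simp
  qed
  have "c \<in> tensor_ker R M N #>\<^bsub>?G\<^esub> c" by (rule G.rcos_self[OF c sub])
  then show ?thesis unfolding tensor_map_def using same by blast
qed

lemma is_submodule_iff: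
  assumes "quotient_field D K"
  shows "is_submodule D K E \<longleftrightarrow> E \<subseteq> carrier K \<and> \<zero>\<^bsub>K\<^esub> \<in> E \<and>
     (\<forall>x \<in> E. \<forall>y \<in> E. x \<oplus>\<^bsub>K\<^esub> y \<in> E) \<and> (\<forall>d \<in> D. \<forall>x \<in> E. d \<otimes>\<^bsub>K\<^esub> x \<in> E)"
proof -
  interpret K: field K using assms by (simp add: quotient_field_def)
  have D: "subring D K"
    using assms by (simp add: quotient_field_def subdomain_def subcring_def)
  have "inv\<^bsub>add_monoid (as_module K (carrier K))\<^esub> x = inv\<^bsub>add_monoid K\<^esub> x" for x
    by (simp add: m_inv_def as_module_def)
  then have inv: "inv\<^bsub>add_monoid (as_module K (carrier K))\<^esub> x = (\<ominus>\<^bsub>K\<^esub> \<one>\<^bsub>K\<^esub>) \<otimes>\<^bsub>K\<^esub> x" if "x \<in> carrier K" for x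
    using that by (simp add: K.l_minus a_inv_def[symmetric])
  have m1: "\<ominus>\<^bsub>K\<^esub> \<one>\<^bsub>K\<^esub> \<in> D" using subringE(3,5)[OF D] by blast
  let ?M = "as_module K (carrier K)"
  have ops: "carrier ?M = carrier K" "\<And>x y. x \<oplus>\<^bsub>?M\<^esub> y = x \<oplus>\<^bsub>K\<^esub> y" "\<zero>\<^bsub>?M\<^esub> = \<zero>\<^bsub>K\<^esub>"
    "\<And>d x. d \<odot>\<^bsub>?M\<^esub> x = d \<otimes>\<^bsub>K\<^esub> x"
    by (simp_all add: as_module_def)
  have "is_submodule D K E \<longleftrightarrow> E \<subseteq> carrier K \<and> (\<forall>x \<in> E. \<forall>y \<in> E. x \<oplus>\<^bsub>K\<^esub> y \<in> E) \<and> \<zero>\<^bsub>K\<^esub> \<in> E \<and>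
      (\<forall>x \<in> E. inv\<^bsub>add_monoid ?M\<^esub> x \<in> E) \<and> (\<forall>d \<in> D. \<forall>x \<in> E. d \<otimes>\<^bsub>K\<^esub> x \<in> E)"
    unfolding submodule_def submodule_axioms_def subgroup_def
    by (simp add: ops Ball_def)
  moreover have "inv\<^bsub>add_monoid ?M\<^esub> x \<in> E"
    if "E \<subseteq> carrier K" "\<forall>d \<in> D. \<forall>x \<in> E. d \<otimes>\<^bsub>K\<^esub> x \<in> E" "x \<in> E" for x
    using inv[of x] m1 that by (metis subsetD)
  ultimately show ?thesis by blast
qed

lemma Fbar_iff:
  assumes "quotient_field D K"
  shows "E \<in> Fbar D K \<longleftrightarrow> E \<subseteq> carrier K \<and> \<zero>\<^bsub>K\<^esub> \<in> E \<and>
     (\<forall>x \<in> E. \<forall>y \<in> E. x \<oplus>\<^bsub>K\<^esub> y \<in> E) \<and> (\<forall>d \<in> D. \<forall>x \<in> E. d \<otimes>\<^bsub>K\<^esub> x \<in> E) \<and>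
     (\<exists>x \<in> E. x \<noteq> \<zero>\<^bsub>K\<^esub>)"
  unfolding Fbar_def mem_Collect_eq is_submodule_iff[OF assms] by blast

lemma Fbar_Int:
  assumes q: "quotient_field D K" and E: "E \<in> Fbar D K" and H: "H \<in> Fbar D K"
  shows "E \<inter> H \<in> Fbar D K"
proof -
  interpret K: field K using q by (simp add: quotient_field_def)
  have D: "subring D K"
    using q by (simp add: quotient_field_def subdomain_def subcring_def)
  have Dc: "d \<in> carrier K" if "d \<in> D" for d using subringE(1)[OF D] that by blast
  note e = E[unfolded Fbar_iff[OF q]] and h = H[unfolded Fbar_iff[OF q]]
  obtain x where x: "x \<in> E" "x \<noteq> \<zero>\<^bsub>K\<^esub>" "x \<in> carrier K" using e by blast
  obtain y where y: "y \<in> H" "y \<noteq> \<zero>\<^bsub>K\<^esub>" "y \<in> carrier K" using h by blast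
  have num: "\<exists>b \<in> D - {\<zero>\<^bsub>K\<^esub>}. b \<otimes>\<^bsub>K\<^esub> z \<in> D - {\<zero>\<^bsub>K\<^esub>}" if z: "z \<in> carrier K" "z \<noteq> \<zero>\<^bsub>K\<^esub>" for z
  proof -
    obtain a b where ab: "a \<in> D" "b \<in> D" "b \<noteq> \<zero>\<^bsub>K\<^esub>" "z = a \<otimes>\<^bsub>K\<^esub> inv\<^bsub>K\<^esub> b"
      using q z unfolding quotient_field_def by blast
    have "b \<otimes>\<^bsub>K\<^esub> z = a"
      using ab Dc by (simp add: K.m_lcomm[of b a] K.field_Units)
    moreover have "a \<noteq> \<zero>\<^bsub>K\<^esub>" using ab z Dc by (auto simp: K.field_Units)
    ultimately show ?thesis using ab by blast
  qed
  obtain b c where b: "b \<in> D" "b \<noteq> \<zero>\<^bsub>K\<^esub>" "b \<otimes>\<^bsub>K\<^esub> x \<in> D" "b \<otimes>\<^bsub>K\<^esub> x \<noteq> \<zero>\<^bsub>K\<^esub>"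
    and c: "c \<in> D" "c \<noteq> \<zero>\<^bsub>K\<^esub>" "c \<otimes>\<^bsub>K\<^esub> y \<in> D" "c \<otimes>\<^bsub>K\<^esub> y \<noteq> \<zero>\<^bsub>K\<^esub>"
    using num[OF x(3,2)] num[OF y(3,2)] by blast
  let ?w = "(b \<otimes>\<^bsub>K\<^esub> x) \<otimes>\<^bsub>K\<^esub> (c \<otimes>\<^bsub>K\<^esub> y)"
  have "?w \<in> H" using h b c y by blast
  moreover have "?w = (c \<otimes>\<^bsub>K\<^esub> y) \<otimes>\<^bsub>K\<^esub> (b \<otimes>\<^bsub>K\<^esub> x)"
    using b c Dc by (simp add: K.m_comm)
  then have "?w \<in> E" using e b c x by simp
  moreover have "?w \<noteq> \<zero>\<^bsub>K\<^esub>" using b c Dc K.integral by blast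
  ultimately show ?thesis unfolding Fbar_iff[OF q] using e h by blast
qed

theorem iota_well_defined:
  assumes q: "quotient_field D K"
  shows "\<iota> D K \<in> Overr D K \<rightarrow>\<^sub>E SStar_f D K"
proof -
  interpret K: field K using q by (simp add: quotient_field_def)
  have D: "subring D K"
    using q by (simp add: quotient_field_def subdomain_def subcring_def)
  have Dc: "d \<in> carrier K" if "d \<in> D" for d using subringE(1)[OF D] that by blast
  note F = Fbar_iff[OF q]
  have Fc: "E \<subseteq> carrier K" if "E \<in> Fbar D K" for E
    using that unfolding F by (elim conjE)
  have "(\<lambda>E \<in> Fbar D K. ideal_prod K E T) \<in> SStar_f D K" if "T \<in> Overr D K" for T
  proof -
    have T: "subring T K" and DT: "D \<subseteq> T" using that by (auto simp: Overr_def)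
    have Tc: "t \<in> carrier K" if "t \<in> T" for t using subringE(1)[OF T] that by blast
    have T0: "\<zero>\<^bsub>K\<^esub> \<in> T" and T1: "\<one>\<^bsub>K\<^esub> \<in> T" using subringE(2,3)[OF T] by auto
    have TT: "s \<otimes>\<^bsub>K\<^esub> t \<in> T" if "s \<in> T" "t \<in> T" for s t using subringE(6)[OF T] that by blast
    let ?p = "\<lambda>E. ideal_prod K E T"
    have mono: "?p E \<subseteq> ?p F" if "E \<subseteq> F" for E F
    proof
      fix x assume "x \<in> ?p E" then show "x \<in> ?p F"
        by induction (use that in \<open>auto intro: ideal_prod.intros\<close>)
    qed
    have carr: "x \<in> carrier K" if "x \<in> ?p E" "E \<subseteq> carrier K" for x E
      using that(1) by induction (use that Tc in auto)
    have ext: "E \<subseteq> ?p E" if "E \<subseteq> carrier K" for E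
    proof
      fix x assume x: "x \<in> E"
      have "x \<otimes>\<^bsub>K\<^esub> \<one>\<^bsub>K\<^esub> \<in> ?p E" using x T1 by (rule ideal_prod.prod)
      then show "x \<in> ?p E" using x that by (simp add: subset_iff)
    qed
    have scal: "z \<otimes>\<^bsub>K\<^esub> x \<in> ?p (z <#\<^bsub>K\<^esub> E)"
      if "x \<in> ?p E" "E \<subseteq> carrier K" "z \<in> carrier K" for x z E
      using that(1)
    proof induction
      case (prod i j)
      have "(z \<otimes>\<^bsub>K\<^esub> i) \<otimes>\<^bsub>K\<^esub> j \<in> ?p (z <#\<^bsub>K\<^esub> E)"
        using prod by (intro ideal_prod.prod) (auto simp: l_coset_def)
      moreover have "i \<in> carrier K" "j \<in> carrier K" using prod that Tc by auto
      ultimately show ?case using that by (simp add: K.m_assoc)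
    next
      case (sum s1 s2)
      then show ?case
        using carr[OF sum(1) that(2)] carr[OF sum(2) that(2)] that
        by (simp add: K.r_distr ideal_prod.sum)
    qed
    have Tsc: "t \<otimes>\<^bsub>K\<^esub> x \<in> ?p E" if "x \<in> ?p E" "E \<subseteq> carrier K" "t \<in> T" for x t E
      using that(1)
    proof induction
      case (prod i j)
      have "i \<otimes>\<^bsub>K\<^esub> (t \<otimes>\<^bsub>K\<^esub> j) \<in> ?p E"
        using prod that by (intro ideal_prod.prod TT) auto
      moreover have "i \<in> carrier K" "j \<in> carrier K" "t \<in> carrier K" using prod that Tc by auto
      ultimately show ?case using that by (simp add: K.m_lcomm)
    next
      case (sum s1 s2)
      then show ?case
        using carr[OF sum(1) that(2)] carr[OF sum(2) that(2)] that Tc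
        by (simp add: K.r_distr ideal_prod.sum)
    qed
    have cl: "?p E \<in> Fbar D K" if E: "E \<in> Fbar D K" for E
    proof -
      have Ec: "E \<subseteq> carrier K" by (rule Fc[OF E])
      show ?thesis
        unfolding F
      proof (intro conjI ballI)
        show "?p E \<subseteq> carrier K" using carr[OF _ Ec] by blast
        show "\<zero>\<^bsub>K\<^esub> \<in> ?p E" "\<exists>x \<in> ?p E. x \<noteq> \<zero>\<^bsub>K\<^esub>" using ext[OF Ec] E[unfolded F] by blast+
        show "d \<otimes>\<^bsub>K\<^esub> x \<in> ?p E" if "d \<in> D" "x \<in> ?p E" for d x
          using Tsc[OF that(2) Ec] DT that(1) by blast
      qed (rule ideal_prod.sum)
    qed
    have idem: "?p (?p E) = ?p E" if E: "E \<in> Fbar D K" for E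
    proof
      have Ec: "E \<subseteq> carrier K" by (rule Fc[OF E])
      show "?p E \<subseteq> ?p (?p E)" by (rule ext) (use carr[OF _ Ec] in blast)
      show "?p (?p E) \<subseteq> ?p E"
      proof
        fix x assume "x \<in> ?p (?p E)"
        then show "x \<in> ?p E"
        proof induction
          case (prod i j)
          then show ?case using Tsc[OF prod(1) Ec prod(2)] carr[OF prod(1) Ec] Tc
            by (simp add: K.m_comm)
        qed (rule ideal_prod.sum)
      qed
    qed
    have zE: "z <#\<^bsub>K\<^esub> E \<in> Fbar D K" if E: "E \<in> Fbar D K" and z: "z \<in> carrier K" "z \<noteq> \<zero>\<^bsub>K\<^esub>" for E z
    proof -
      note e = E[unfolded F]
      have ec: "x \<in> carrier K" if "x \<in> E" for x using e that by blast
      have mem: "y \<in> z <#\<^bsub>K\<^esub> E \<longleftrightarrow> (\<exists>x \<in> E. y = z \<otimes>\<^bsub>K\<^esub> x)" for y by (auto simp: l_coset_def)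
      show ?thesis
        unfolding F
      proof (intro conjI ballI)
        show "z <#\<^bsub>K\<^esub> E \<subseteq> carrier K" using ec z by (auto simp: l_coset_def)
        show "\<zero>\<^bsub>K\<^esub> \<in> z <#\<^bsub>K\<^esub> E" unfolding mem using e z by (auto intro!: bexI[of _ "\<zero>\<^bsub>K\<^esub>"])
        show "x \<oplus>\<^bsub>K\<^esub> y \<in> z <#\<^bsub>K\<^esub> E" if "x \<in> z <#\<^bsub>K\<^esub> E" "y \<in> z <#\<^bsub>K\<^esub> E" for x y
        proof -
          from that obtain u v where uv: "u \<in> E" "v \<in> E" "x = z \<otimes>\<^bsub>K\<^esub> u" "y = z \<otimes>\<^bsub>K\<^esub> v"
            unfolding mem by blast
          then have "x \<oplus>\<^bsub>K\<^esub> y = z \<otimes>\<^bsub>K\<^esub> (u \<oplus>\<^bsub>K\<^esub> v)" using ec z by (simp add: K.r_distr)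
          then show ?thesis unfolding mem using e uv by blast
        qed
        show "d \<otimes>\<^bsub>K\<^esub> x \<in> z <#\<^bsub>K\<^esub> E" if "d \<in> D" "x \<in> z <#\<^bsub>K\<^esub> E" for d x
        proof -
          from that obtain u where u: "u \<in> E" "x = z \<otimes>\<^bsub>K\<^esub> u" unfolding mem by blast
          then have "d \<otimes>\<^bsub>K\<^esub> x = z \<otimes>\<^bsub>K\<^esub> (d \<otimes>\<^bsub>K\<^esub> u)" using ec z Dc[OF that(1)] by (simp add: K.m_lcomm)
          then show ?thesis unfolding mem using e u that by blast
        qed
        obtain x where x: "x \<in> E" "x \<noteq> \<zero>\<^bsub>K\<^esub>" using e by blast
        then have "z \<otimes>\<^bsub>K\<^esub> x \<noteq> \<zero>\<^bsub>K\<^esub>" using K.integral[of z x] z ec by blast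
        then show "\<exists>x \<in> z <#\<^bsub>K\<^esub> E. x \<noteq> \<zero>\<^bsub>K\<^esub>" unfolding Bex_def mem using x by blast
      qed
    qed
    have hom: "?p (z <#\<^bsub>K\<^esub> E) = z <#\<^bsub>K\<^esub> ?p E"
      if E: "E \<in> Fbar D K" and z: "z \<in> carrier K" for E z
    proof
      have Ec: "E \<subseteq> carrier K" by (rule Fc[OF E])
      show "z <#\<^bsub>K\<^esub> ?p E \<subseteq> ?p (z <#\<^bsub>K\<^esub> E)"
        using scal[OF _ Ec z] by (auto simp: l_coset_def)
      show "?p (z <#\<^bsub>K\<^esub> E) \<subseteq> z <#\<^bsub>K\<^esub> ?p E"
      proof
        fix x assume "x \<in> ?p (z <#\<^bsub>K\<^esub> E)"
        then show "x \<in> z <#\<^bsub>K\<^esub> ?p E"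
        proof induction
          case (prod i j)
          then obtain u where u: "u \<in> E" "i = z \<otimes>\<^bsub>K\<^esub> u" by (auto simp: l_coset_def)
          then have "i \<otimes>\<^bsub>K\<^esub> j = z \<otimes>\<^bsub>K\<^esub> (u \<otimes>\<^bsub>K\<^esub> j)" using Ec z Tc prod by (auto simp: K.m_assoc)
          moreover have "u \<otimes>\<^bsub>K\<^esub> j \<in> ?p E" using u prod by (auto intro: ideal_prod.prod)
          ultimately show ?case by (auto simp: l_coset_def)
        next
          case (sum s1 s2)
          then obtain u v where uv: "u \<in> ?p E" "v \<in> ?p E" "s1 = z \<otimes>\<^bsub>K\<^esub> u" "s2 = z \<otimes>\<^bsub>K\<^esub> v"
            by (auto simp: l_coset_def)
          then have "s1 \<oplus>\<^bsub>K\<^esub> s2 = z \<otimes>\<^bsub>K\<^esub> (u \<oplus>\<^bsub>K\<^esub> v)" using carr[OF _ Ec] z by (simp add: K.r_distr)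
          moreover have "u \<oplus>\<^bsub>K\<^esub> v \<in> ?p E" using uv by (auto intro: ideal_prod.sum)
          ultimately show ?case by (auto simp: l_coset_def)
        qed
      qed
    qed
    have den: "\<exists>d \<in> D - {\<zero>\<^bsub>K\<^esub>}. \<forall>x \<in> S. d \<otimes>\<^bsub>K\<^esub> x \<in> D" if "finite S" "S \<subseteq> carrier K" for S
      using that
    proof induction
      case empty
      have "\<one>\<^bsub>K\<^esub> \<in> D - {\<zero>\<^bsub>K\<^esub>}" using subringE(3)[OF D] by simp
      then show ?case by blast
    next
      case (insert x S)
      then obtain d where d: "d \<in> D" "d \<noteq> \<zero>\<^bsub>K\<^esub>" "\<And>x. x \<in> S \<Longrightarrow> d \<otimes>\<^bsub>K\<^esub> x \<in> D" by blast
      obtain a b where ab: "a \<in> D" "b \<in> D" "b \<noteq> \<zero>\<^bsub>K\<^esub>" "x = a \<otimes>\<^bsub>K\<^esub> inv\<^bsub>K\<^esub> b"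
        using q insert.prems unfolding quotient_field_def by blast
      have bx: "b \<otimes>\<^bsub>K\<^esub> x = a" using ab Dc by (simp add: K.m_lcomm[of b a] K.field_Units)
      have "(d \<otimes>\<^bsub>K\<^esub> b) \<otimes>\<^bsub>K\<^esub> x \<in> D"
        using bx ab d Dc insert subringE(6)[OF D] by (simp add: K.m_assoc)
      moreover have "(d \<otimes>\<^bsub>K\<^esub> b) \<otimes>\<^bsub>K\<^esub> y \<in> D" if "y \<in> S" for y
      proof -
        have "y \<in> carrier K" using insert that by blast
        then have "(d \<otimes>\<^bsub>K\<^esub> b) \<otimes>\<^bsub>K\<^esub> y = b \<otimes>\<^bsub>K\<^esub> (d \<otimes>\<^bsub>K\<^esub> y)"
          using ab d Dc by (simp add: K.m_assoc K.m_lcomm)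
        then show ?thesis using subringE(6)[OF D] ab d that by simp
      qed
      moreover have "d \<otimes>\<^bsub>K\<^esub> b \<in> D" "d \<otimes>\<^bsub>K\<^esub> b \<noteq> \<zero>\<^bsub>K\<^esub>"
        using subringE(6)[OF D] ab d Dc K.integral[of d b] by auto
      ultimately show ?case by blast
    qed
    have hull: "is_submodule D K (is_submodule D K hull S)" if "S \<subseteq> carrier K" for S
    proof -
      have "is_submodule D K (carrier K)" unfolding is_submodule_iff[OF q] using Dc by auto
      with that have c: "is_submodule D K hull S \<subseteq> carrier K" by (rule hull_minimal)
      have mem: "x \<in> is_submodule D K hull S \<longleftrightarrow> (\<forall>N. is_submodule D K N \<longrightarrow> S \<subseteq> N \<longrightarrow> x \<in> N)" for x
        by (auto simp: hull_def)
      show ?thesis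
        unfolding is_submodule_iff[OF q, of "is_submodule D K hull S"]
      proof (intro conjI ballI c)
        show "\<zero>\<^bsub>K\<^esub> \<in> is_submodule D K hull S"
          unfolding mem unfolding is_submodule_iff[OF q] by simp
        show "x \<oplus>\<^bsub>K\<^esub> y \<in> is_submodule D K hull S"
          if "x \<in> is_submodule D K hull S" "y \<in> is_submodule D K hull S" for x y
          using that unfolding mem unfolding is_submodule_iff[OF q] by simp
        show "d \<otimes>\<^bsub>K\<^esub> x \<in> is_submodule D K hull S"
          if "d \<in> D" "x \<in> is_submodule D K hull S" for d x
          using that unfolding mem unfolding is_submodule_iff[OF q] by simp
      qed
    qed
    have fg: "is_submodule D K hull S \<in> fg_fractional D K"
      if S: "finite S" "S \<subseteq> carrier K" "\<exists>x \<in> S. x \<noteq> \<zero>\<^bsub>K\<^esub>" for S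
    proof -
      let ?H = "is_submodule D K hull S"
      have SH: "S \<subseteq> ?H" by (rule hull_subset)
      have "?H \<in> Fbar D K" unfolding Fbar_def using hull[OF S(2)] S(3) SH by blast
      moreover obtain d where d: "d \<in> D" "d \<noteq> \<zero>\<^bsub>K\<^esub>" "\<And>x. x \<in> S \<Longrightarrow> d \<otimes>\<^bsub>K\<^esub> x \<in> D"
        using den[OF S(1,2)] by blast
      let ?N = "{x \<in> carrier K. d \<otimes>\<^bsub>K\<^esub> x \<in> D}"
      have "is_submodule D K ?N"
        unfolding is_submodule_iff[OF q]
        using d(1) Dc subringE(2,6,7)[OF D] by (auto simp: K.r_distr K.m_lcomm)
      then have "?H \<subseteq> ?N" by (intro hull_minimal) (use S d in auto)
      ultimately show ?thesis unfolding fg_fractional_def using d S by blast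
    qed
    have ft: "?p E = \<Union> {?p F | F. F \<subseteq> E \<and> F \<in> fg_fractional D K}" if E: "E \<in> Fbar D K" for E
    proof
      show "\<Union> {?p F | F. F \<subseteq> E \<and> F \<in> fg_fractional D K} \<subseteq> ?p E" using mono by blast
      have Ec: "E \<subseteq> carrier K" and Es: "is_submodule D K E" using Fc[OF E] E by (auto simp: Fbar_def)
      obtain e where e: "e \<in> E" "e \<noteq> \<zero>\<^bsub>K\<^esub>" using E[unfolded F] by blast
      have "\<exists>S. finite S \<and> S \<subseteq> E \<and> x \<in> ?p (is_submodule D K hull S)" if "x \<in> ?p E" for x
        using that
      proof induction
        case (prod i j)
        have "i \<in> is_submodule D K hull {i}" using hull_subset[of "{i}"] by blast
        then show ?case using prod by (intro exI[of _ "{i}"]) (auto intro: ideal_prod.prod)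
      next
        case (sum s1 s2)
        then obtain S1 S2 where S: "finite S1" "S1 \<subseteq> E" "s1 \<in> ?p (is_submodule D K hull S1)"
          "finite S2" "S2 \<subseteq> E" "s2 \<in> ?p (is_submodule D K hull S2)" by blast
        let ?H = "is_submodule D K hull (S1 \<union> S2)"
        have "s1 \<in> ?p ?H" "s2 \<in> ?p ?H"
          using S(3,6) mono[OF hull_mono[of S1 "S1 \<union> S2"]] mono[OF hull_mono[of S2 "S1 \<union> S2"]] by blast+
        then show ?case using S by (intro exI[of _ "S1 \<union> S2"]) (auto intro: ideal_prod.sum)
      qed
      moreover have "x \<in> \<Union> {?p F | F. F \<subseteq> E \<and> F \<in> fg_fractional D K}"
        if "finite S" "S \<subseteq> E" "x \<in> ?p (is_submodule D K hull S)" for x S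
      proof -
        let ?H = "is_submodule D K hull (insert e S)"
        have "?H \<in> fg_fractional D K" using fg[of "insert e S"] that e Ec by blast
        moreover have "?H \<subseteq> E" by (rule hull_minimal[where S = "is_submodule D K"]) (use that e Es in auto)
        moreover have "x \<in> ?p ?H"
          using that(3) mono[OF hull_mono[of S "insert e S"]] by blast
        ultimately show ?thesis by blast
      qed
      ultimately show "?p E \<subseteq> \<Union> {?p F | F. F \<subseteq> E \<and> F \<in> fg_fractional D K}" by blast
    qed
    have sub: "F \<in> Fbar D K" if "F \<in> fg_fractional D K" for F
      using that by (simp add: fg_fractional_def)
    have "(\<lambda>E \<in> Fbar D K. ?p E) \<in> semistar D K"
      unfolding semistar_def mem_Collect_eq
    proof (intro conjI ballI impI)
      show "(\<lambda>E \<in> Fbar D K. ?p E) \<in> Fbar D K \<rightarrow>\<^sub>E Fbar D K" using cl by simp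
      fix E assume E: "E \<in> Fbar D K"
      show "E \<subseteq> (\<lambda>E \<in> Fbar D K. ?p E) E" using E Fc[OF E] ext[of E] by simp
      show "(\<lambda>E \<in> Fbar D K. ?p E) ((\<lambda>E \<in> Fbar D K. ?p E) E) = (\<lambda>E \<in> Fbar D K. ?p E) E"
        using E cl idem by simp
    next
      fix z E assume "z \<in> carrier K - {\<zero>\<^bsub>K\<^esub>}" "E \<in> Fbar D K"
      then show "(\<lambda>E \<in> Fbar D K. ?p E) (z <#\<^bsub>K\<^esub> E) = z <#\<^bsub>K\<^esub> (\<lambda>E \<in> Fbar D K. ?p E) E"
        using zE hom by simp
    next
      fix E F assume "E \<in> Fbar D K" "F \<in> Fbar D K" "E \<subseteq> F"
      then show "(\<lambda>E \<in> Fbar D K. ?p E) E \<subseteq> (\<lambda>E \<in> Fbar D K. ?p E) F" using mono by simp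
    qed
    moreover have "{(\<lambda>E \<in> Fbar D K. ?p E) F | F. F \<subseteq> E \<and> F \<in> fg_fractional D K} =
        {?p F | F. F \<subseteq> E \<and> F \<in> fg_fractional D K}" for E
      by (rule Collect_cong) (metis restrict_apply' sub)
    ultimately show ?thesis unfolding SStar_f_def using ft by simp
  qed
  then show ?thesis unfolding \<iota>_def by auto
qed

end

theory Submission
  imports Defs
begin

text \<open>
  For \<open>t \<in> T\<close> let \<open>(D : t) = {d \<in> D. d t \<in> D}\<close> be the ideal of denominators of \<open>t\<close>.  Both
  sides of the equivalence amount to Richman's criterion: \<open>(D : t) T = T\<close> for every \<open>t \<in> T\<close>.

  Stability implies the criterion because, for \<open>t \<noteq> 0\<close>, the ideal \<open>(D : t)\<close> is the intersection of \<open>D\<close> with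
  \<open>t\<inverse> D\<close>, and the extensions of these two submodules to \<open>T\<close> both contain \<open>1\<close>.
  Flatness implies it by a computation with the finitely generated module \<open>D + D t\<close>, given at
  \<open>denominators_trivial_if_flat\<close>; its test modules are submodules of \<open>K\<close>, hence live in a
  copy of the type of \<open>K\<close> inside any sum type.

  Conversely, the ideals \<open>J\<close> of \<open>D\<close> with \<open>J T = T\<close> are closed under finite intersections
  (\<open>trivial_ext_Int\<close>).  Under the criterion they therefore supply common denominators for any finite
  set of elements of \<open>T\<close>, and everything about \<open>T\<close> can be tested after multiplying by such a
  \<open>J\<close>.  For submodules of \<open>K\<close> this says that \<open>x \<in> E T\<close> iff \<open>J x \<subseteq> E\<close> for some such
  \<open>J\<close>, a condition that visibly commutes with intersections of submodules; so the operation is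
  stable.  For an element \<open>z\<close> of \<open>T \<otimes> N\<close> it says that \<open>d z = 1 \<otimes> n\<^sub>d\<close> with
  \<open>n\<^sub>d \<in> N\<close> for all \<open>d\<close> in some \<open>J\<close> (\<open>scale_eq_clear\<close>), and that a vanishing \<open>z\<close> has
  \<open>n\<^sub>d = 0\<close> for all \<open>d\<close> in some \<open>J\<close> (\<open>clear_tensor_ker\<close>).  If \<open>z\<close> dies in
  \<open>T \<otimes> N'\<close> for some \<open>N'\<close> containing \<open>N\<close>, then \<open>n\<^sub>d = 0\<close> in \<open>N'\<close> and so in
  \<open>N\<close>; thus \<open>J z = 0\<close> and \<open>z \<in> T z = T J z = 0\<close>.  This proves flatness, over test modules
  of every type.
\<close>

section \<open>Tensor products by generators and relations\<close>

lemma keys_diff_subset: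
  "\<lbrakk>Poly_Mapping.keys a \<subseteq> S; Poly_Mapping.keys b \<subseteq> S\<rbrakk> \<Longrightarrow> Poly_Mapping.keys (a - b :: _ \<Rightarrow>\<^sub>0 int) \<subseteq> S"
  using keys_diff[of a b] by blast

lemma tensor_ker_subgroup:
  assumes "module R M" "module R N"
  shows "subgroup (tensor_ker R M N) (tensor_free M N)"
  unfolding tensor_ker_def
  by (intro group.generate_is_subgroup tensor_rels_subset assms group_free_Abelian_group)

lemma tensor_ker_carrier:
  assumes "module R M" "module R N" "c \<in> tensor_ker R M N"
  shows "Poly_Mapping.keys c \<subseteq> carrier M \<times> carrier N"
  using subgroup.mem_carrier[OF tensor_ker_subgroup[OF assms(1,2)] assms(3)] by simp

lemma tensor_ker_rels: "c \<in> tensor_rels R M N \<Longrightarrow> c \<in> tensor_ker R M N"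
  unfolding tensor_ker_def by (rule generate.incl)

lemma tensor_ker_add_left:
  assumes "x \<in> carrier M" "y \<in> carrier M" "n \<in> carrier N"
  shows "frag_of (x \<oplus>\<^bsub>M\<^esub> y, n) - frag_of (x, n) - frag_of (y, n) \<in> tensor_ker R M N"
  using assms by (intro tensor_ker_rels) (unfold tensor_rels_def, blast)

lemma tensor_ker_add_right:
  assumes "x \<in> carrier M" "n \<in> carrier N" "p \<in> carrier N"
  shows "frag_of (x, n \<oplus>\<^bsub>N\<^esub> p) - frag_of (x, n) - frag_of (x, p) \<in> tensor_ker R M N"
  using assms by (intro tensor_ker_rels) (unfold tensor_rels_def, blast)

lemma tensor_ker_smult:
  assumes "r \<in> carrier R" "x \<in> carrier M" "n \<in> carrier N"
  shows "frag_of (r \<odot>\<^bsub>M\<^esub> x, n) - frag_of (x, r \<odot>\<^bsub>N\<^esub> n) \<in> tensor_ker R M N"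
  using assms by (intro tensor_ker_rels) (unfold tensor_rels_def, blast)

lemma tensor_ker_zero: "0 \<in> tensor_ker R M N"
  unfolding tensor_ker_def using generate.one[of "tensor_free M N"] by simp

lemma tensor_ker_add:
  assumes "a \<in> tensor_ker R M N" "b \<in> tensor_ker R M N"
  shows "a + b \<in> tensor_ker R M N"
  using assms generate.eng[of a "tensor_free M N" _ b] by (simp add: tensor_ker_def)

lemma tensor_ker_minus:
  assumes "module R M" "module R N" "a \<in> tensor_ker R M N"
  shows "- a \<in> tensor_ker R M N"
  using subgroup.m_inv_closed[OF tensor_ker_subgroup[OF assms(1,2)] assms(3)]
    tensor_ker_carrier[OF assms] by simp

lemma tensor_ker_diff:
  assumes "module R M" "module R N" "a \<in> tensor_ker R M N" "b \<in> tensor_ker R M N"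
  shows "a - b \<in> tensor_ker R M N"
  using tensor_ker_add[OF assms(3) tensor_ker_minus[OF assms(1,2,4)]] by simp

lemma tensor_ker_cancel:
  assumes "a - b \<in> tensor_ker R M N" "b \<in> tensor_ker R M N"
  shows "a \<in> tensor_ker R M N"
  using tensor_ker_add[OF assms] by simp

text \<open>The differences cover sums and inverses at once, so a property of relations extends to the
  whole subgroup as soon as it is additive in this weak sense.\<close>

lemma tensor_ker_induct [consumes 3, case_names zero diff add_left add_right smult]:
  assumes M: "module R M" and N: "module R N" and c: "c \<in> tensor_ker R M N"
    and zero: "P 0"
    and diff: "\<And>a b. \<lbrakk>Poly_Mapping.keys a \<subseteq> carrier M \<times> carrier N;
        Poly_Mapping.keys b \<subseteq> carrier M \<times> carrier N; P a; P b\<rbrakk> \<Longrightarrow> P (a - b)"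
    and add_left: "\<And>x y n. \<lbrakk>x \<in> carrier M; y \<in> carrier M; n \<in> carrier N\<rbrakk> \<Longrightarrow>
        P (frag_of (x \<oplus>\<^bsub>M\<^esub> y, n) - frag_of (x, n) - frag_of (y, n))"
    and add_right: "\<And>x n p. \<lbrakk>x \<in> carrier M; n \<in> carrier N; p \<in> carrier N\<rbrakk> \<Longrightarrow>
        P (frag_of (x, n \<oplus>\<^bsub>N\<^esub> p) - frag_of (x, n) - frag_of (x, p))"
    and smult: "\<And>r x n. \<lbrakk>r \<in> carrier R; x \<in> carrier M; n \<in> carrier N\<rbrakk> \<Longrightarrow>
        P (frag_of (r \<odot>\<^bsub>M\<^esub> x, n) - frag_of (x, r \<odot>\<^bsub>N\<^esub> n))"
  shows "P c"
proof -
  have rels: "P r \<and> Poly_Mapping.keys r \<subseteq> carrier M \<times> carrier N" if "r \<in> tensor_rels R M N" for r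
  proof
    show "P r" using that add_left add_right smult unfolding tensor_rels_def by blast
    show "Poly_Mapping.keys r \<subseteq> carrier M \<times> carrier N"
      using tensor_ker_carrier[OF M N tensor_ker_rels[OF that]] .
  qed
  have neg: "P (- a)" if "Poly_Mapping.keys a \<subseteq> carrier M \<times> carrier N" "P a" for a
    using diff[of 0 a] zero that by simp
  have "P c \<and> Poly_Mapping.keys c \<subseteq> carrier M \<times> carrier N"
    using c unfolding tensor_ker_def
  proof induction
    case one then show ?case using zero by simp
  next
    case (incl h) then show ?case by (rule rels)
  next
    case (inv h) then show ?case using rels[OF inv] neg[of h] by (simp add: keys_minus)
  next
    case (eng a b)
    then have "P (a - - b)" by (intro diff neg) (simp_all add: keys_minus)
    moreover have "Poly_Mapping.keys (a - - b) \<subseteq> carrier M \<times> carrier N"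
      using eng by (intro keys_diff_subset) (simp_all add: keys_minus)
    ultimately show ?case by simp
  qed
  then show ?thesis ..
qed

lemma frag_extend_module_hom_keys:
  assumes "f \<in> module_hom R N N'" "Poly_Mapping.keys c \<subseteq> carrier M \<times> carrier N"
  shows "Poly_Mapping.keys (frag_extend (\<lambda>(m, n). frag_of (m, f n)) c :: _ \<Rightarrow>\<^sub>0 int)
    \<subseteq> carrier M \<times> carrier N'"
proof -
  have "f n \<in> carrier N'" if "n \<in> carrier N" for n using assms(1) that by (auto simp: module_hom_def)
  then show ?thesis
    using keys_frag_extend[of "\<lambda>(m, n). frag_of (m, f n)" c] assms(2)
    by (fastforce split: prod.splits)
qed

lemma tensor_coset_eq_iff:
  assumes M: "module R M" and N: "module R N"
    and a: "Poly_Mapping.keys a \<subseteq> carrier M \<times> carrier N"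
    and b: "Poly_Mapping.keys b \<subseteq> carrier M \<times> carrier N"
  shows "tensor_ker R M N #>\<^bsub>tensor_free M N\<^esub> a = tensor_ker R M N #>\<^bsub>tensor_free M N\<^esub> b
    \<longleftrightarrow> a - b \<in> tensor_ker R M N"
proof -
  let ?G = "tensor_free M N" and ?H = "tensor_ker R M N"
  interpret G: group ?G by simp
  note sub = tensor_ker_subgroup[OF M N]
  have mem: "a \<in> ?H #>\<^bsub>?G\<^esub> b \<longleftrightarrow> a - b \<in> ?H"
    by (auto simp: r_coset_def) (metis add_diff_cancel diff_add_cancel)+
  show ?thesis
  proof
    assume "?H #>\<^bsub>?G\<^esub> a = ?H #>\<^bsub>?G\<^esub> b"
    then show "a - b \<in> ?H" using G.rcos_self[of a ?H] sub a mem by simp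
  next
    assume "a - b \<in> ?H"
    then show "?H #>\<^bsub>?G\<^esub> a = ?H #>\<^bsub>?G\<^esub> b"
      using G.repr_independence[of a ?H b] sub b mem by simp
  qed
qed

text \<open>This moves flatness from cosets to formal sums, where the calculations below take place: the map
  is a homomorphism, so injectivity is triviality of its kernel.\<close>

lemma inj_tensor_map_iff:
  assumes M: "module R M" and N: "module R N" and N': "module R N'" and f: "f \<in> module_hom R N N'"
  shows "inj_on (tensor_map R M N' f) (carrier (tensor R M N)) \<longleftrightarrow>
    (\<forall>c. Poly_Mapping.keys c \<subseteq> carrier M \<times> carrier N \<longrightarrow>
      frag_extend (\<lambda>(m, n). frag_of (m, f n)) c \<in> tensor_ker R M N' \<longrightarrow> c \<in> tensor_ker R M N)"
    (is "?L \<longleftrightarrow> ?R")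
proof -
  let ?h = "frag_extend (\<lambda>(m, n). frag_of (m, f n)) :: _ \<Rightarrow> (_ \<times> _) \<Rightarrow>\<^sub>0 int"
  let ?cos = "\<lambda>c. tensor_ker R M N #>\<^bsub>tensor_free M N\<^esub> c"
  have carr: "carrier (tensor R M N) = ?cos ` {c. Poly_Mapping.keys c \<subseteq> carrier M \<times> carrier N}"
    unfolding tensor_def FactGroup_def RCOSETS_def by auto
  have eq: "tensor_map R M N' f (?cos a) = tensor_map R M N' f (?cos b)
      \<longleftrightarrow> ?h (a - b) \<in> tensor_ker R M N'"
    if "Poly_Mapping.keys a \<subseteq> carrier M \<times> carrier N" "Poly_Mapping.keys b \<subseteq> carrier M \<times> carrier N" for a b
    using that
    by (simp add: tensor_map_coset[OF M N N' f] tensor_coset_eq_iff[OF M N']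
        frag_extend_module_hom_keys[OF f] frag_extend_diff)
  show ?thesis
  proof
    assume L: ?L
    show ?R
    proof (intro allI impI)
      fix c assume c: "Poly_Mapping.keys c \<subseteq> carrier M \<times> carrier N" "?h c \<in> tensor_ker R M N'"
      then have "?cos c = ?cos 0" using L[unfolded carr] eq[of c 0] by (auto dest: inj_onD)
      then show "c \<in> tensor_ker R M N" using tensor_coset_eq_iff[OF M N c(1), of 0] by simp
    qed
  next
    assume R: ?R
    show ?L
      unfolding carr
    proof (rule inj_onI, clarify)
      fix a b
      assume ab: "Poly_Mapping.keys a \<subseteq> carrier M \<times> carrier N" "Poly_Mapping.keys b \<subseteq> carrier M \<times> carrier N"
        and e: "tensor_map R M N' f (?cos a) = tensor_map R M N' f (?cos b)"
      have "Poly_Mapping.keys (a - b) \<subseteq> carrier M \<times> carrier N" using ab by (rule keys_diff_subset)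
      then have "a - b \<in> tensor_ker R M N" using R eq[OF ab] e by blast
      then show "?cos a = ?cos b" using tensor_coset_eq_iff[OF M N ab] by simp
    qed
  qed
qed

text \<open>The homomorphism from a free abelian group with prescribed values on the generators.  Its values
  off the group generated by \<open>S\<close> are arbitrary.\<close>

definition additive_extension ::
  "('x, 'y) ring_scheme \<Rightarrow> 'k set \<Rightarrow> ('k \<Rightarrow> 'x) \<Rightarrow> ('k \<Rightarrow>\<^sub>0 int) \<Rightarrow> 'x" where
  "additive_extension A S g =
    (SOME h. h \<in> hom (free_Abelian_group S) (add_monoid A) \<and> (\<forall>x \<in> S. h (frag_of x) = g x))"

lemma additive_extension:
  assumes A: "abelian_group A" and g: "\<And>x. x \<in> S \<Longrightarrow> g x \<in> carrier A"
  shows additive_extension_of: "x \<in> S \<Longrightarrow> additive_extension A S g (frag_of x) = g x"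
    and additive_extension_closed:
      "Poly_Mapping.keys a \<subseteq> S \<Longrightarrow> additive_extension A S g a \<in> carrier A"
    and additive_extension_zero: "additive_extension A S g 0 = \<zero>\<^bsub>A\<^esub>"
    and additive_extension_diff:
      "\<lbrakk>Poly_Mapping.keys a \<subseteq> S; Poly_Mapping.keys b \<subseteq> S\<rbrakk> \<Longrightarrow>
        additive_extension A S g (a - b) = additive_extension A S g a \<ominus>\<^bsub>A\<^esub> additive_extension A S g b"
proof -
  interpret A: abelian_group A by fact
  have gS: "g ` S \<subseteq> carrier (add_monoid A)" using g by auto
  obtain h where h: "h \<in> hom (free_Abelian_group S) (add_monoid A)" "\<And>x. x \<in> S \<Longrightarrow> h (frag_of x) = g x"
    using comm_group.free_Abelian_group_universal[OF A.a_comm_group gS] by blast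
  then have "\<exists>h. h \<in> hom (free_Abelian_group S) (add_monoid A) \<and> (\<forall>x \<in> S. h (frag_of x) = g x)"
    by blast
  from someI_ex[OF this]
  have h: "additive_extension A S g \<in> hom (free_Abelian_group S) (add_monoid A)"
    "\<And>x. x \<in> S \<Longrightarrow> additive_extension A S g (frag_of x) = g x"
    unfolding additive_extension_def by blast+
  interpret h: group_hom "free_Abelian_group S" "add_monoid A" "additive_extension A S g"
    by (intro group_hom.intro group_hom_axioms.intro h A.a_group) simp
  show "x \<in> S \<Longrightarrow> additive_extension A S g (frag_of x) = g x" by (rule h(2))
  show cl: "Poly_Mapping.keys a \<subseteq> S \<Longrightarrow> additive_extension A S g a \<in> carrier A" for a
    using h.hom_closed[of a] by simp
  show "additive_extension A S g 0 = \<zero>\<^bsub>A\<^esub>" using h.hom_one by simp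
  show "additive_extension A S g (a - b) = additive_extension A S g a \<ominus>\<^bsub>A\<^esub> additive_extension A S g b"
    if ab: "Poly_Mapping.keys a \<subseteq> S" "Poly_Mapping.keys b \<subseteq> S"
  proof -
    have "additive_extension A S g (a + - b) = additive_extension A S g a \<oplus>\<^bsub>A\<^esub> additive_extension A S g (- b)"
      using h.hom_mult[of a "- b"] ab by (simp add: keys_minus)
    moreover have "additive_extension A S g (- b) = \<ominus>\<^bsub>A\<^esub> additive_extension A S g b"
      using h.hom_inv[of b] ab by (simp add: a_inv_def)
    ultimately show ?thesis by (simp add: A.minus_eq)
  qed
qed

lemma (in abelian_group) add_minus_minus:
  assumes "x \<in> carrier G" "y \<in> carrier G" shows "x \<oplus> y \<ominus> x \<ominus> y = \<zero>"
proof -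
  have "x \<oplus> y \<ominus> x \<ominus> y = (x \<oplus> y) \<oplus> \<ominus> (x \<oplus> y)"
    using assms by (simp add: minus_eq minus_add a_assoc)
  then show ?thesis using assms by (simp add: r_neg)
qed

section \<open>Ideals that become trivial in an overring\<close>

locale overring = field K for K (structure) +
  fixes D T
  assumes quotient_field: "quotient_field D K" and overring: "T \<in> Overr D K"
begin

abbreviation "R \<equiv> K\<lparr>carrier := D\<rparr>"

lemma subring_D: "subring D K"
  using quotient_field by (simp add: quotient_field_def subdomain_def subcring_def)

lemma subring_T: "subring T K" and D_T: "d \<in> D \<Longrightarrow> d \<in> T"
  using overring by (auto simp: Overr_def)

lemmas D_closed [simp] = subringE(2,3,5-7)[OF subring_D]
lemmas T_closed [simp] = subringE(2,3,5-7)[OF subring_T]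

lemma D_carrier [simp]: "d \<in> D \<Longrightarrow> d \<in> carrier K"
  and T_carrier [simp]: "t \<in> T \<Longrightarrow> t \<in> carrier K"
  using subringE(1)[OF subring_D] subringE(1)[OF subring_T] by auto

lemma D_diff [simp]: "x \<in> D \<Longrightarrow> y \<in> D \<Longrightarrow> x \<ominus> y \<in> D" by (simp add: minus_eq)

lemma cring_R: "cring R"
  using subcring_iff[of D] quotient_field subringE(1)[OF subring_D]
  by (simp add: quotient_field_def subdomain_def)

text \<open>Below, \<open>ideal_prod K E T\<close> is the extension \<open>E T\<close> of a subset \<open>E\<close> of \<open>K\<close>.\<close>

lemma ext_carrier:
  assumes "x \<in> ideal_prod K E T" "E \<subseteq> carrier K" shows "x \<in> carrier K"
  using assms by induction auto

lemma ext_smult: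
  assumes "x \<in> ideal_prod K E T" "E \<subseteq> carrier K" "t \<in> T"
  shows "t \<otimes> x \<in> ideal_prod K E T"
  using assms
proof induction
  case (prod i j)
  then have "i \<otimes> (t \<otimes> j) \<in> ideal_prod K E T" by (intro ideal_prod.prod) auto
  moreover have "i \<otimes> (t \<otimes> j) = t \<otimes> (i \<otimes> j)" using prod by (intro m_lcomm) auto
  ultimately show ?case by simp
next
  case (sum x y)
  then show ?case using ext_carrier by (simp add: r_distr ideal_prod.sum)
qed

lemma ext_diff:
  assumes "x \<in> ideal_prod K E T" "y \<in> ideal_prod K E T" "E \<subseteq> carrier K"
  shows "x \<ominus> y \<in> ideal_prod K E T"
proof -
  have "(\<ominus> \<one>) \<otimes> y \<in> ideal_prod K E T" using assms by (intro ext_smult) auto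
  moreover have "(\<ominus> \<one>) \<otimes> y = \<ominus> y" using ext_carrier[OF assms(2,3)] by (simp add: l_minus)
  ultimately show ?thesis using assms by (simp add: minus_eq ideal_prod.sum)
qed

text \<open>These sets are closed under multiplication by \<open>D\<close> and satisfy \<open>J T = T\<close>.  Their additive
  spans are the ideals of \<open>D\<close> that become trivial in \<open>T\<close>, as a set and its span have the same
  extension.\<close>

definition trivial_ext :: "'a set \<Rightarrow> bool" where
  "trivial_ext J \<longleftrightarrow> J \<subseteq> D \<and> (\<forall>d \<in> D. \<forall>x \<in> J. d \<otimes> x \<in> J) \<and> \<one> \<in> ideal_prod K J T"

lemma trivial_ext_D: "trivial_ext D"
  using ideal_prod.prod[of \<one> D \<one> T K] by (auto simp: trivial_ext_def)

lemma trivial_ext_subset: "trivial_ext J \<Longrightarrow> d \<in> J \<Longrightarrow> d \<in> D"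
  by (auto simp: trivial_ext_def)

text \<open>If \<open>1 = \<Sum> a\<^sub>i s\<^sub>i\<close> and \<open>1 = \<Sum> b\<^sub>j r\<^sub>j\<close> with \<open>a\<^sub>i \<in> I\<close> and \<open>b\<^sub>j \<in> J\<close>, then the product of
  the two sums has coefficients \<open>a\<^sub>i b\<^sub>j \<in> I \<inter> J\<close>.\<close>

lemma trivial_ext_Int:
  assumes "trivial_ext I" "trivial_ext J"
  shows "trivial_ext (I \<inter> J)"
proof -
  note IJ = assms[unfolded trivial_ext_def]
  have Ic: "I \<subseteq> carrier K" "J \<subseteq> carrier K" using IJ by auto
  have *: "x \<otimes> y \<in> ideal_prod K (I \<inter> J) T" if "x \<in> ideal_prod K I T" "y \<in> ideal_prod K J T" for x y
    using that(1)
  proof induction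
    case (prod i s)
    from that(2) show ?case
    proof induction
      case (prod j r)
      have c: "i \<in> carrier K" "j \<in> carrier K" "s \<in> carrier K" "r \<in> carrier K"
        using prod \<open>i \<in> I\<close> \<open>s \<in> T\<close> Ic by auto
      have "j \<otimes> i \<in> I" "i \<otimes> j \<in> J" using IJ \<open>i \<in> I\<close> prod by blast+
      then have "(i \<otimes> j) \<otimes> (s \<otimes> r) \<in> ideal_prod K (I \<inter> J) T"
        using prod \<open>s \<in> T\<close> c by (intro ideal_prod.prod) (auto simp: m_comm)
      moreover have "(i \<otimes> j) \<otimes> (s \<otimes> r) = (i \<otimes> s) \<otimes> (j \<otimes> r)" using c by (simp add: m_ac)
      ultimately show ?case by simp
    next
      case (sum x y)
      moreover have "i \<otimes> s \<in> carrier K" using \<open>i \<in> I\<close> \<open>s \<in> T\<close> Ic by auto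
      ultimately show ?case using ext_carrier[OF _ Ic(2)] by (simp add: r_distr ideal_prod.sum)
    qed
  next
    case (sum x1 x2)
    then show ?case
      using ext_carrier[OF _ Ic(1)] ext_carrier[OF that(2) Ic(2)] by (simp add: l_distr ideal_prod.sum)
  qed
  have "\<one> \<in> ideal_prod K (I \<inter> J) T" using *[of \<one> \<one>] IJ by simp
  then show ?thesis using IJ unfolding trivial_ext_def by blast
qed

text \<open>Multiply \<open>x\<close> by an expression of \<open>1\<close> as an element of \<open>J T\<close>.\<close>

lemma ext_if_trivial_ext_multiples:
  assumes J: "trivial_ext J" and x: "x \<in> carrier K"
    and dx: "\<And>d. d \<in> J \<Longrightarrow> d \<otimes> x \<in> E"
  shows "x \<in> ideal_prod K E T"
proof -
  have Jc: "J \<subseteq> carrier K" using J by (auto simp: trivial_ext_def)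
  have "y \<otimes> x \<in> ideal_prod K E T" if "y \<in> ideal_prod K J T" for y
    using that
  proof induction
    case (prod d s)
    have "(d \<otimes> x) \<otimes> s \<in> ideal_prod K E T" using prod dx by (intro ideal_prod.prod)
    moreover have "(d \<otimes> x) \<otimes> s = (d \<otimes> s) \<otimes> x" using prod x Jc by (auto simp: m_ac)
    ultimately show ?case by simp
  next
    case (sum y z)
    then show ?case using ext_carrier[OF _ Jc] x by (simp add: l_distr ideal_prod.sum)
  qed
  from this[of \<one>] show ?thesis using J x by (simp add: trivial_ext_def)
qed

definition denominators :: "'a \<Rightarrow> 'a set" where
  "denominators t = {d \<in> D. d \<otimes> t \<in> D}"

text \<open>Richman's criterion.\<close>

definition denominators_trivial :: bool where
  "denominators_trivial \<longleftrightarrow> (\<forall>t \<in> T. \<one> \<in> ideal_prod K (denominators t) T)"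

lemma trivial_ext_denominators:
  assumes denominators_trivial "t \<in> T" shows "trivial_ext (denominators t)"
  using assms by (auto simp: trivial_ext_def denominators_trivial_def denominators_def m_assoc)

section \<open>Stability\<close>

text \<open>Under the criterion, \<open>ext_if_trivial_ext_multiples\<close> has a converse: if \<open>x = \<Sum> e\<^sub>i t\<^sub>i\<close> with \<open>e\<^sub>i \<in> E\<close>, a common
  denominator \<open>d\<close> of the \<open>t\<^sub>i\<close> gives \<open>d x \<in> E\<close>.\<close>

lemma multiples_if_ext:
  assumes R: denominators_trivial and E: "E \<in> Fbar D K" and x: "x \<in> ideal_prod K E T"
  shows "\<exists>J. trivial_ext J \<and> (\<forall>d \<in> J. d \<otimes> x \<in> E)"
  using x
proof induction
  note e = E[unfolded Fbar_iff[OF quotient_field]]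
  case (prod i t)
  have "d \<otimes> (i \<otimes> t) \<in> E" if "d \<in> denominators t" for d
  proof -
    have "d \<otimes> (i \<otimes> t) = (d \<otimes> t) \<otimes> i" using that prod e by (auto simp: denominators_def m_ac)
    then show ?thesis using that prod e by (auto simp: denominators_def)
  qed
  then show ?case using trivial_ext_denominators[OF R] prod by blast
next
  note e = E[unfolded Fbar_iff[OF quotient_field]]
  case (sum x y)
  then obtain I J where IJ: "trivial_ext I" "trivial_ext J" "\<forall>d \<in> I. d \<otimes> x \<in> E" "\<forall>d \<in> J. d \<otimes> y \<in> E"
    by blast
  have c: "x \<in> carrier K" "y \<in> carrier K" using sum ext_carrier e by blast+
  have "d \<otimes> (x \<oplus> y) \<in> E" if "d \<in> I \<inter> J" for d
  proof -
    have "d \<otimes> (x \<oplus> y) = d \<otimes> x \<oplus> d \<otimes> y" using that c IJ trivial_ext_subset by (simp add: r_distr)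
    then show ?thesis using that e IJ by auto
  qed
  then show ?case using trivial_ext_Int[OF IJ(1,2)] by auto
qed

lemma stable_iff_denominators_trivial:
  "stable D K (\<iota> D K T) \<longleftrightarrow> denominators_trivial"
proof -
  have iota: "\<iota> D K T E = ideal_prod K E T" if "E \<in> Fbar D K" for E
    using that overring by (simp add: \<iota>_def)
  have st: "stable D K (\<iota> D K T) \<longleftrightarrow> (\<forall>E \<in> Fbar D K. \<forall>H \<in> Fbar D K.
      ideal_prod K (E \<inter> H) T = ideal_prod K E T \<inter> ideal_prod K H T)"
  proof -
    have "\<iota> D K T (E \<inter> H) = \<iota> D K T E \<inter> \<iota> D K T H \<longleftrightarrow>
        ideal_prod K (E \<inter> H) T = ideal_prod K E T \<inter> ideal_prod K H T"
      if "E \<in> Fbar D K" "H \<in> Fbar D K" for E H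
      by (simp only: iota[OF that(1)] iota[OF that(2)] iota[OF Fbar_Int[OF quotient_field that]])
    then show ?thesis unfolding stable_def by (meson ball_cong)
  qed
  show ?thesis
  proof
    assume s: "stable D K (\<iota> D K T)"
    show denominators_trivial
      unfolding denominators_trivial_def
    proof
      fix t assume t: "t \<in> T"
      let ?H = "{x \<in> carrier K. x \<otimes> t \<in> D}"
      \<comment> \<open>The submodule \<open>?H\<close> is \<open>t\<inverse> D\<close>, or all of \<open>K\<close> if \<open>t = 0\<close>; in either case \<open>u\<close>
        is a nonzero element of it that divides \<open>1\<close> in \<open>T\<close>.\<close>
      define u where "u = (if t = \<zero> then \<one> else inv t)"
      have u: "u \<in> carrier K \<and> u \<noteq> \<zero> \<and> u \<otimes> t \<in> D \<and> (\<exists>s \<in> T. \<one> = u \<otimes> s)"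
      proof (cases "t = \<zero>")
        case True
        have "\<one> = \<one> \<otimes> \<one>" by simp
        then show ?thesis using True by (metis u_def T_closed(2) D_closed(1) one_closed one_not_zero r_null)
      next
        case False
        then have "t \<in> Units K" using t field_Units by simp
        then have "inv t \<in> carrier K" "inv t \<otimes> t = \<one>" by simp_all
        moreover from this have "inv t \<noteq> \<zero>" using t by (metis T_carrier l_null one_not_zero)
        ultimately show ?thesis using False t by (auto simp: u_def intro!: bexI[of _ t])
      qed
      have D: "D \<in> Fbar D K"
        unfolding Fbar_iff[OF quotient_field] by (auto intro: bexI[of _ \<one>])
      have H: "?H \<in> Fbar D K"
        unfolding Fbar_iff[OF quotient_field] using t u by (simp add: l_distr m_assoc subset_iff) blast
      obtain s where "s \<in> T" "\<one> = u \<otimes> s" using u by blast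
      then have "\<one> \<in> ideal_prod K ?H T" using u ideal_prod.prod[of u ?H s T K] by simp
      then have "\<one> \<in> ideal_prod K (D \<inter> ?H) T"
        using trivial_ext_D s[unfolded st, rule_format, OF D H] by (simp add: trivial_ext_def)
      moreover have "D \<inter> ?H = denominators t" by (auto simp: denominators_def)
      ultimately show "\<one> \<in> ideal_prod K (denominators t) T" by simp
    qed
  next
    assume R: denominators_trivial
    have mono: "ideal_prod K E T \<subseteq> ideal_prod K H T" if "E \<subseteq> H" for E H
    proof
      fix x assume "x \<in> ideal_prod K E T" then show "x \<in> ideal_prod K H T"
        by induction (use that in \<open>auto intro: ideal_prod.intros\<close>)
    qed
    have "x \<in> ideal_prod K (E \<inter> H) T"
      if E: "E \<in> Fbar D K" and H: "H \<in> Fbar D K" and x: "x \<in> ideal_prod K E T" "x \<in> ideal_prod K H T" for E H x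
    proof -
      obtain I J where IJ: "trivial_ext I" "trivial_ext J" "\<forall>d \<in> I. d \<otimes> x \<in> E" "\<forall>d \<in> J. d \<otimes> x \<in> H"
        using multiples_if_ext[OF R] E H x by meson
      have Ec: "E \<subseteq> carrier K" using E unfolding Fbar_iff[OF quotient_field] by blast
      show ?thesis
        by (rule ext_if_trivial_ext_multiples[OF trivial_ext_Int[OF IJ(1,2)]])
          (use IJ Ec ext_carrier[OF x(1)] in auto)
    qed
    then show "stable D K (\<iota> D K T)" unfolding st using mono by blast
  qed
qed

section \<open>Denominators of elements of a flat overring\<close>

text \<open>A submodule of \<open>K\<close> is turned into a test module over a larger type by renaming its elements
  along an injection \<open>i\<close>.  All operations are transported from \<open>K\<close>, so that \<^const>\<open>as_module\<close>
  is the case \<open>i = id\<close>.\<close>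

definition relabelled_module :: "('a \<Rightarrow> 'n) \<Rightarrow> 'a set \<Rightarrow> ('a, 'n) module" where
  "relabelled_module i E = \<lparr>carrier = i ` E, monoid.mult = (\<lambda>x y. i (the_inv i x \<otimes> the_inv i y)),
     one = i \<one>, ring.zero = i \<zero>, add = (\<lambda>x y. i (the_inv i x \<oplus> the_inv i y)),
     smult = (\<lambda>d x. i (d \<otimes> the_inv i x))\<rparr>"

lemma relabelled_module_simps:
  assumes "inj i"
  shows "carrier (relabelled_module i E) = i ` E" "\<zero>\<^bsub>relabelled_module i E\<^esub> = i \<zero>"
    "i x \<oplus>\<^bsub>relabelled_module i E\<^esub> i y = i (x \<oplus> y)" "d \<odot>\<^bsub>relabelled_module i E\<^esub> i x = i (d \<otimes> x)"
  using assms by (simp_all add: relabelled_module_def the_inv_f_f)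

lemma module_relabelled_module:
  assumes i: "inj i" and E: "is_submodule D K E"
  shows "module R (relabelled_module i E)"
proof -
  note e = E[unfolded is_submodule_iff[OF quotient_field]]
  have ec: "x \<in> carrier K" if "x \<in> E" for x using e that by blast
  note simps = relabelled_module_simps[OF i]
  show ?thesis
  proof (rule moduleI)
    show "cring R" by (rule cring_R)
    show "abelian_group (relabelled_module i E)"
    proof (rule abelian_groupI; (unfold simps(1))?; (elim imageE; hypsubst)?; (unfold simps)?)
      fix x assume x: "x \<in> E"
      have "\<ominus> x = (\<ominus> \<one>) \<otimes> x" using ec[OF x] by (simp add: l_minus)
      then have "\<ominus> x \<in> E" using e x by auto
      then show "\<exists>y \<in> i ` E. y \<oplus>\<^bsub>relabelled_module i E\<^esub> i x = i \<zero>"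
        using ec[OF x] by (intro bexI[of _ "i (\<ominus> x)"]) (auto simp: simps l_neg)
    qed (use e ec in \<open>simp_all add: a_ac\<close>)
  qed (use e ec in \<open>auto simp: simps l_distr r_distr m_assoc\<close>)
qed

lemma as_module_eq_relabelled_module: "as_module K E = relabelled_module id E"
proof -
  have "the_inv (id :: 'a \<Rightarrow> 'a) = id" by (rule ext) (use the_inv_f_f[of id] in simp)
  then show ?thesis by (simp only: as_module_def relabelled_module_def id_apply image_id)
qed

lemma submodule_T: "is_submodule D K T"
  unfolding is_submodule_iff[OF quotient_field] using D_T by auto

abbreviation "M \<equiv> as_module K T"

lemma module_M: "module R M"
  unfolding as_module_eq_relabelled_module by (rule module_relabelled_module[OF inj_on_id submodule_T])

lemma M_simps [simp]: "carrier M = T" "x \<oplus>\<^bsub>M\<^esub> y = x \<oplus> y" "d \<odot>\<^bsub>M\<^esub> x = d \<otimes> x"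
  by (simp_all add: as_module_def)

text \<open>Flatness is tested on the inclusion of \<open>E = D + D t\<close> into \<open>K\<close>.  In \<open>T \<otimes> K\<close> the elements
  \<open>t \<otimes> 1\<close> and \<open>1 \<otimes> t\<close> agree: with \<open>t = a / b\<close> both equal \<open>a \<otimes> (1 / b)\<close>.  So they agree already in
  \<open>T \<otimes> E\<close>.  On \<open>E\<close> the coefficient \<open>q\<close> of an element \<open>p + q t\<close> is unique modulo \<open>(D : t)\<close>, so that
  \<open>s \<otimes> (p + q t) \<mapsto> s q\<close> is a well-defined map from \<open>T \<otimes> E\<close> to \<open>T / (D : t) T\<close>.  It sends
  \<open>t \<otimes> 1\<close> to \<open>0\<close> and \<open>1 \<otimes> t\<close> to \<open>1\<close>, whence \<open>1 \<in> (D : t) T\<close>.\<close>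

lemma denominators_trivial_if_flat:
  assumes flat: "flat TYPE('a + 'u) R M"
  shows denominators_trivial
  unfolding denominators_trivial_def
proof
  fix t assume t: "t \<in> T"
  define E where "E = {p \<oplus> q \<otimes> t | p q. p \<in> D \<and> q \<in> D}"
  let ?N = "relabelled_module Inl E :: ('a, 'a + 'u) module"
  let ?N' = "relabelled_module Inl (carrier K) :: ('a, 'a + 'u) module"
  have tc: "t \<in> carrier K" using t by simp
  have Ec: "x \<in> carrier K" if "x \<in> E" for x using that tc by (auto simp: E_def)
  have E_I: "p \<oplus> q \<otimes> t \<in> E" if "p \<in> D" "q \<in> D" for p q using that E_def by blast
  have inl: "inj (Inl :: 'a \<Rightarrow> 'a + 'u)" by simp
  note simps = relabelled_module_simps[OF inl]
  have add_mem: "x \<oplus> y \<in> E" if "x \<in> E" "y \<in> E" for x y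
  proof -
    from that obtain p q p' q' where pq: "p \<in> D" "q \<in> D" "p' \<in> D" "q' \<in> D"
      "x = p \<oplus> q \<otimes> t" "y = p' \<oplus> q' \<otimes> t" by (auto simp: E_def)
    then have "x \<oplus> y = (p \<oplus> p') \<oplus> (q \<oplus> q') \<otimes> t" using tc by (simp add: l_distr a_ac)
    then show ?thesis using E_I[of "p \<oplus> p'" "q \<oplus> q'"] pq by simp
  qed
  have smult_mem: "d \<otimes> x \<in> E" if "d \<in> D" "x \<in> E" for x d
  proof -
    from that obtain p q where pq: "p \<in> D" "q \<in> D" "x = p \<oplus> q \<otimes> t" by (auto simp: E_def)
    then have "d \<otimes> x = d \<otimes> p \<oplus> (d \<otimes> q) \<otimes> t" using tc that by (simp add: r_distr m_assoc)
    then show ?thesis using E_I[of "d \<otimes> p" "d \<otimes> q"] pq that by simp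
  qed
  have one_E: "\<one> \<in> E" and zero_E: "\<zero> \<in> E" and t_E: "t \<in> E"
    using E_I[of \<one> \<zero>] E_I[of \<zero> \<zero>] E_I[of \<zero> \<one>] tc by simp_all
  have N: "module R ?N"
    by (rule module_relabelled_module[OF inl])
      (use Ec add_mem smult_mem zero_E in \<open>auto simp: is_submodule_iff[OF quotient_field]\<close>)
  have N': "module R ?N'"
    by (rule module_relabelled_module[OF inl]) (auto simp: is_submodule_iff[OF quotient_field])
  have f: "id \<in> module_hom R ?N ?N'"
    using Ec by (auto simp: module_hom_def simps)
  define c where "c = frag_of (t, Inl \<one> :: 'a + 'u) - frag_of (\<one>, Inl t)"
  \<comment> \<open>Pass from \<open>t \<otimes> 1 = t \<otimes> b b\<inverse>\<close> through \<open>a \<otimes> b\<inverse>\<close> to \<open>1 \<otimes> a b\<inverse>\<close>.\<close>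
  have c_ker': "c \<in> tensor_ker R M ?N'"
  proof -
    obtain a b where ab: "a \<in> D" "b \<in> D" "b \<noteq> \<zero>" "t = a \<otimes> inv b"
      using quotient_field tc unfolding quotient_field_def by blast
    have "b \<in> Units K" using ab by (simp add: field_Units)
    then have b: "inv b \<in> carrier K" "b \<otimes> inv b = \<one>" by simp_all
    have bt: "b \<otimes> t = a" using ab b by (simp add: m_lcomm[of b a])
    have 1: "frag_of (r \<otimes> x, Inl n) - frag_of (x, Inl (r \<otimes> n)) \<in> tensor_ker R M ?N'"
      if "r \<in> D" "x \<in> T" "n \<in> carrier K" for r x n
      using tensor_ker_smult[of r R x M "Inl n" ?N'] that by (simp add: simps)
    have 2: "frag_of (a, Inl (inv b)) - frag_of (t, Inl \<one> :: 'a + 'u) \<in> tensor_ker R M ?N'"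
      using 1[of b t "inv b"] ab(2) t b bt by simp
    have 3: "frag_of (a, Inl (inv b)) - frag_of (\<one>, Inl t :: 'a + 'u) \<in> tensor_ker R M ?N'"
      using 1[of a \<one> "inv b"] ab b by simp
    show ?thesis
      using tensor_ker_diff[OF module_M N' 3 2] unfolding c_def by (simp add: algebra_simps)
  qed
  have c_keys: "Poly_Mapping.keys c \<subseteq> carrier M \<times> carrier ?N"
  proof -
    have "Poly_Mapping.keys c \<subseteq> {(t, Inl \<one>), (\<one>, Inl t)}" unfolding c_def using keys_diff by force
    then show ?thesis using t one_E t_E by (auto simp: simps)
  qed
  have "frag_extend (\<lambda>(m, n). frag_of (m, id n)) c = c" unfolding c_def by (simp add: frag_extend_diff)
  then have c_ker: "c \<in> tensor_ker R M ?N"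
    using flat N N' f c_keys c_ker' inj_tensor_map_iff[OF module_M N N' f]
    unfolding flat_def by (metis inj_on_id)
  \<comment> \<open>A choice of the coefficient of \<open>t\<close>; only its residue modulo \<open>(D : t)\<close> is determined.\<close>
  define q where "q x = (SOME q. q \<in> D \<and> (\<exists>p \<in> D. x = p \<oplus> q \<otimes> t))" for x
  have q: "q x \<in> D" "\<exists>p \<in> D. x = p \<oplus> q x \<otimes> t" if "x \<in> E" for x
  proof -
    have "\<exists>q. q \<in> D \<and> (\<exists>p \<in> D. x = p \<oplus> q \<otimes> t)" using that by (auto simp: E_def)
    from someI_ex[OF this] show "q x \<in> D" "\<exists>p \<in> D. x = p \<oplus> q x \<otimes> t" by (auto simp: q_def)
  qed
  let ?I = "denominators t"
  let ?P = "ideal_prod K ?I T"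
  have Ic: "?I \<subseteq> carrier K" by (auto simp: denominators_def)
  have q_unique: "q x \<ominus> r \<in> ?I" if x: "x \<in> E" "x = p \<oplus> r \<otimes> t" "p \<in> D" "r \<in> D" for x p r
  proof -
    obtain p' where p': "p' \<in> D" "x = p' \<oplus> q x \<otimes> t" using q(2)[OF x(1)] by blast
    have c: "q x \<in> carrier K" "r \<in> carrier K" "p \<in> carrier K" "p' \<in> carrier K" "t \<in> carrier K"
      using p'(1) q(1)[OF x(1)] x(3,4) tc by simp_all
    have "(q x \<ominus> r) \<otimes> t = (p' \<oplus> q x \<otimes> t) \<ominus> p' \<ominus> r \<otimes> t"
      using c by algebra
    also have "\<dots> = (p \<oplus> r \<otimes> t) \<ominus> p' \<ominus> r \<otimes> t" using p'(2) x(2) by simp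
    also have "\<dots> = p \<ominus> p'" using c by algebra
    finally have "(q x \<ominus> r) \<otimes> t \<in> D" using p' x by simp
    then show ?thesis using q(1)[OF x(1)] x(4) by (simp add: denominators_def)
  qed
  define g where "g = (\<lambda>(s, n :: 'a + 'u). s \<otimes> q (projl n))"
  let ?S = "carrier M \<times> carrier ?N"
  have g: "g x \<in> carrier K" if "x \<in> ?S" for x using that q(1) by (auto simp: g_def simps)
  define \<psi> where "\<psi> = additive_extension K ?S g"
  have psi_diff: "\<psi> (a - b) = \<psi> a \<ominus> \<psi> b"
    if "Poly_Mapping.keys a \<subseteq> ?S" "Poly_Mapping.keys b \<subseteq> ?S" for a b
    unfolding \<psi>_def using that g by (intro additive_extension_diff[OF is_abelian_group])
  have psi_of: "\<psi> (frag_of (s, Inl n)) = s \<otimes> q n" if "s \<in> T" "n \<in> E" for s n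
    using additive_extension_of[OF is_abelian_group, of ?S g "(s, Inl n)", OF g, folded \<psi>_def] that
    by (simp add: simps g_def)
  have keys_of: "Poly_Mapping.keys (frag_of (s, Inl n :: 'a + 'u)) \<subseteq> ?S" if "s \<in> T" "n \<in> E" for s n
    using that by (simp add: simps)
  have psi_2: "\<psi> (frag_of (s, Inl n) - frag_of (s', Inl n')) = s \<otimes> q n \<ominus> s' \<otimes> q n'"
    if "s \<in> T" "n \<in> E" "s' \<in> T" "n' \<in> E" for s n s' n'
    using psi_diff[OF keys_of keys_of] psi_of that by metis
  have psi_3: "\<psi> (frag_of (s, Inl n) - frag_of (s', Inl n') - frag_of (s'', Inl n'')) =
      s \<otimes> q n \<ominus> s' \<otimes> q n' \<ominus> s'' \<otimes> q n''"
    if "s \<in> T" "n \<in> E" "s' \<in> T" "n' \<in> E" "s'' \<in> T" "n'' \<in> E" for s n s' n' s'' n''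
    using psi_diff[OF keys_diff_subset[OF keys_of keys_of] keys_of] psi_2 psi_of that by metis
  have P0: "\<zero> \<in> ?P" using ideal_prod.prod[of \<zero> ?I \<zero> T K] tc by (simp add: denominators_def)
  have psi_ker: "\<psi> z \<in> ?P" if "z \<in> tensor_ker R M ?N" for z
    using module_M N that
  proof (induction rule: tensor_ker_induct)
    case zero
    then show ?case using additive_extension_zero[OF is_abelian_group, of ?S g, OF g, folded \<psi>_def] P0 by simp
  next
    case (diff a b)
    then show ?case using psi_diff[of a b] ext_diff[OF _ _ Ic] by simp
  next
    case (add_left x y n)
    then obtain m where m: "m \<in> E" "n = Inl m" by (auto simp: simps)
    have c: "x \<in> T" "y \<in> T" using add_left by simp_all
    have "\<psi> (frag_of (x \<oplus> y, n) - frag_of (x, n) - frag_of (y, n)) = (x \<oplus> y) \<otimes> q m \<ominus> x \<otimes> q m \<ominus> y \<otimes> q m"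
      unfolding m(2) using m c by (intro psi_3) simp_all
    also have "\<dots> = \<zero>"
      using D_carrier[OF q(1)[OF m(1)]] T_carrier[OF c(1)] T_carrier[OF c(2)] by algebra
    finally show ?case using P0 by simp
  next
    case (add_right x n p)
    then obtain m k where m: "m \<in> E" "n = Inl m" "k \<in> E" "p = Inl k" by (auto simp: simps)
    have c: "x \<in> T" using add_right by simp
    obtain u v where uv: "u \<in> D" "v \<in> D" "m = u \<oplus> q m \<otimes> t" "k = v \<oplus> q k \<otimes> t"
      using q(2) m by meson
    note qD = q(1)[OF m(1)] q(1)[OF m(3)] q(1)[OF add_mem[OF m(1,3)]]
    have "m \<oplus> k = (u \<oplus> q m \<otimes> t) \<oplus> (v \<oplus> q k \<otimes> t)" using uv(3,4) by simp
    also have "\<dots> = (u \<oplus> v) \<oplus> (q m \<oplus> q k) \<otimes> t" using uv(1,2) qD tc by (simp add: l_distr a_ac)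
    finally have "q (m \<oplus> k) \<ominus> (q m \<oplus> q k) \<in> ?I"
      using uv(1,2) qD by (intro q_unique[of _ "u \<oplus> v"] add_mem m) simp_all
    then have "(q (m \<oplus> k) \<ominus> (q m \<oplus> q k)) \<otimes> x \<in> ?P" using c by (rule ideal_prod.prod)
    moreover have "\<psi> (frag_of (x, Inl (m \<oplus> k)) - frag_of (x, n) - frag_of (x, p)) =
        x \<otimes> q (m \<oplus> k) \<ominus> x \<otimes> q m \<ominus> x \<otimes> q k"
      unfolding m(2,4) using m c add_mem by (intro psi_3)
    moreover have "x \<otimes> q (m \<oplus> k) \<ominus> x \<otimes> q m \<ominus> x \<otimes> q k = (q (m \<oplus> k) \<ominus> (q m \<oplus> q k)) \<otimes> x"
      using T_carrier[OF c] qD[THEN D_carrier] by algebra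
    ultimately show ?case by (simp add: m simps)
  next
    case (smult r x n)
    then obtain m where m: "m \<in> E" "n = Inl m" by (auto simp: simps)
    have c: "r \<in> D" "x \<in> T" using smult by simp_all
    obtain u where u: "u \<in> D" "m = u \<oplus> q m \<otimes> t" using q(2) m by meson
    note qD = q(1)[OF m(1)] q(1)[OF smult_mem[OF c(1) m(1)]]
    have "r \<otimes> m = r \<otimes> (u \<oplus> q m \<otimes> t)" using u(2) by simp
    also have "\<dots> = r \<otimes> u \<oplus> (r \<otimes> q m) \<otimes> t" using u(1) qD c tc by (simp add: r_distr m_assoc)
    finally have "q (r \<otimes> m) \<ominus> r \<otimes> q m \<in> ?I"
      using u(1) qD c by (intro q_unique[of _ "r \<otimes> u"] smult_mem m) simp_all
    then have "(q (r \<otimes> m) \<ominus> r \<otimes> q m) \<otimes> (\<ominus> x) \<in> ?P" using c by (intro ideal_prod.prod) auto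
    moreover have "\<psi> (frag_of (r \<otimes> x, n) - frag_of (x, Inl (r \<otimes> m))) = (r \<otimes> x) \<otimes> q m \<ominus> x \<otimes> q (r \<otimes> m)"
      unfolding m(2) using m c smult_mem D_T by (intro psi_2) simp_all
    moreover have "(r \<otimes> x) \<otimes> q m \<ominus> x \<otimes> q (r \<otimes> m) = (q (r \<otimes> m) \<ominus> r \<otimes> q m) \<otimes> (\<ominus> x)"
      using D_carrier[OF c(1)] T_carrier[OF c(2)] qD[THEN D_carrier] by algebra
    ultimately show ?case by (simp add: m simps)
  qed
  have "\<psi> c = t \<otimes> q \<one> \<ominus> \<one> \<otimes> q t"
    unfolding c_def using t one_E t_E by (intro psi_2) simp_all
  then have 1: "t \<otimes> q \<one> \<ominus> q t \<in> ?P" using psi_ker[OF c_ker] q(1)[OF t_E] by simp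
  have "q \<one> \<ominus> \<zero> \<in> ?I" by (rule q_unique[OF one_E, of \<one>]) (use tc in auto)
  then have 2: "q \<one> \<otimes> t \<in> ?P" using q(1)[OF one_E] t by (intro ideal_prod.prod) (auto simp: minus_eq)
  have "q t \<ominus> \<one> \<in> ?I" by (rule q_unique[OF t_E, of \<zero>]) (use tc in auto)
  then have 3: "(q t \<ominus> \<one>) \<otimes> \<one> \<in> ?P" by (intro ideal_prod.prod) auto
  have "q \<one> \<otimes> t \<ominus> (t \<otimes> q \<one> \<ominus> q t) \<ominus> (q t \<ominus> \<one>) \<otimes> \<one> \<in> ?P"
    by (rule ext_diff[OF ext_diff[OF 2 1 Ic] 3 Ic])
  moreover have "q \<one> \<otimes> t \<ominus> (t \<otimes> q \<one> \<ominus> q t) \<ominus> (q t \<ominus> \<one>) \<otimes> \<one> = \<one>"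
    using tc D_carrier[OF q(1)[OF one_E]] D_carrier[OF q(1)[OF t_E]] by algebra
  ultimately show "\<one> \<in> ideal_prod K (denominators t) T" by simp
qed

section \<open>Flatness by clearing denominators\<close>

text \<open>The action of \<open>T\<close> on \<open>T \<otimes> N\<close>, on representatives.\<close>

definition scale :: "'a \<Rightarrow> ('a \<times> 'n \<Rightarrow>\<^sub>0 int) \<Rightarrow> ('a \<times> 'n \<Rightarrow>\<^sub>0 int)" where
  "scale s = frag_extend (\<lambda>(t, n). frag_of (s \<otimes> t, n))"

lemma scale_simps [simp]:
  "scale s (frag_of (t, n)) = frag_of (s \<otimes> t, n)" "scale s 0 = 0" "scale s (a - b) = scale s a - scale s b"
  by (simp_all add: scale_def frag_extend_diff)

lemma scale_scale:
  assumes "Poly_Mapping.keys c \<subseteq> T \<times> S" "s \<in> T" "r \<in> T"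
  shows "scale s (scale r c) = scale (s \<otimes> r) c"
  using assms(1) by (induction c rule: frag_induction) (use assms(2,3) in \<open>auto simp: m_assoc\<close>)

lemma scale_one:
  assumes "Poly_Mapping.keys c \<subseteq> T \<times> S" shows "scale \<one> c = c"
  using assms by (induction c rule: frag_induction) auto

lemma scale_tensor_ker:
  assumes N: "module R N" and c: "c \<in> tensor_ker R M N" and s: "s \<in> T"
  shows "scale s c \<in> tensor_ker R M N"
  using module_M N c
proof (induction rule: tensor_ker_induct)
  case zero
  show ?case by (simp add: tensor_ker_zero)
next
  case (diff a b)
  then show ?case by (simp add: tensor_ker_diff[OF module_M N])
next
  case (add_left x y n)
  then show ?case using s tensor_ker_add_left[of "s \<otimes> x" M "s \<otimes> y" n N R] by (simp add: r_distr)
next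
  case (add_right x n p)
  then show ?case using s tensor_ker_add_right[of "s \<otimes> x" M n N p R] by simp
next
  case (smult r x n)
  then have "r \<otimes> (s \<otimes> x) = s \<otimes> (r \<otimes> x)" using s by (simp add: m_lcomm)
  then show ?case using smult s tensor_ker_smult[of r R "s \<otimes> x" M n N] by simp
qed

lemma scale_add_tensor_ker:
  assumes N: "module R N" and c: "Poly_Mapping.keys c \<subseteq> T \<times> carrier N" and s: "s \<in> T" "r \<in> T"
  shows "scale (s \<oplus> r) c - scale s c - scale r c \<in> tensor_ker R M N"
  using c
proof (induction c rule: frag_induction)
  case zero
  show ?case by (simp add: tensor_ker_zero)
next
  case (one x)
  then obtain t n where x: "x = (t, n)" "t \<in> T" "n \<in> carrier N" by auto
  then show ?case
    using s tensor_ker_add_left[of "s \<otimes> t" M "r \<otimes> t" n N R] by (simp add: l_distr)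
next
  case (diff a b)
  from tensor_ker_diff[OF module_M N diff] show ?case by (simp add: algebra_simps)
qed

text \<open>The annihilator in \<open>T\<close> of an element of \<open>T \<otimes> N\<close> is an ideal of \<open>T\<close>; if it contains
  \<open>J\<close>, it contains \<open>J T\<close>, hence \<open>1\<close>.\<close>

lemma tensor_ker_if_scale:
  assumes N: "module R N" and c: "Poly_Mapping.keys c \<subseteq> T \<times> carrier N"
    and J: "trivial_ext J" and scale: "\<And>d. d \<in> J \<Longrightarrow> scale d c \<in> tensor_ker R M N"
  shows "c \<in> tensor_ker R M N"
proof -
  have "y \<in> T \<and> scale y c \<in> tensor_ker R M N" if "y \<in> ideal_prod K J T" for y
    using that
  proof induction
    case (prod d s)
    have d: "d \<in> T" using prod J D_T trivial_ext_subset by blast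
    have "scale s (scale d c) \<in> tensor_ker R M N" using prod scale scale_tensor_ker[OF N] by blast
    moreover have "s \<otimes> d = d \<otimes> s" using d prod by (simp add: m_comm)
    ultimately show ?case using d prod by (simp add: scale_scale[OF c])
  next
    case (sum x y)
    then have xy: "scale x c + scale y c \<in> tensor_ker R M N" using tensor_ker_add by blast
    have "scale (x \<oplus> y) c - (scale x c + scale y c) \<in> tensor_ker R M N"
      using scale_add_tensor_ker[OF N c, of x y] sum by (simp add: algebra_simps)
    then show ?case using tensor_ker_cancel[OF _ xy] sum by simp
  qed
  from this[of \<one>] J show ?thesis using scale_one[OF c] by (simp add: trivial_ext_def)
qed

text \<open>Clearing denominators: if \<open>d\<close> is a denominator of all \<open>t\<^sub>i\<close>, then \<open>d (\<Sum> t\<^sub>i \<otimes> n\<^sub>i)\<close> is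
  \<open>1 \<otimes> \<Sum> (d t\<^sub>i) n\<^sub>i\<close>, and \<^term>\<open>clear N d\<close> is the second factor.  Summands for which \<open>d\<close> is no
  denominator are dropped.  This makes the map additive for each fixed \<open>d\<close>, and the
  choice of a suitable \<open>d\<close> can be postponed.\<close>

definition clear :: "('a, 'n, 'm) module_scheme \<Rightarrow> 'a \<Rightarrow> ('a \<times> 'n \<Rightarrow>\<^sub>0 int) \<Rightarrow> 'n" where
  "clear N d = additive_extension N (T \<times> carrier N)
     (\<lambda>(t, n). if d \<otimes> t \<in> D then (d \<otimes> t) \<odot>\<^bsub>N\<^esub> n else \<zero>\<^bsub>N\<^esub>)"

lemma clear:
  assumes N: "module R N"
  shows clear_of: "\<lbrakk>t \<in> T; n \<in> carrier N\<rbrakk> \<Longrightarrow>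
      clear N d (frag_of (t, n)) = (if d \<otimes> t \<in> D then (d \<otimes> t) \<odot>\<^bsub>N\<^esub> n else \<zero>\<^bsub>N\<^esub>)"
    and clear_closed: "Poly_Mapping.keys a \<subseteq> T \<times> carrier N \<Longrightarrow> clear N d a \<in> carrier N"
    and clear_zero: "clear N d 0 = \<zero>\<^bsub>N\<^esub>"
    and clear_diff: "\<lbrakk>Poly_Mapping.keys a \<subseteq> T \<times> carrier N; Poly_Mapping.keys b \<subseteq> T \<times> carrier N\<rbrakk> \<Longrightarrow>
      clear N d (a - b) = clear N d a \<ominus>\<^bsub>N\<^esub> clear N d b"
proof -
  interpret N: module R N by fact
  let ?g = "\<lambda>(t, n). if d \<otimes> t \<in> D then (d \<otimes> t) \<odot>\<^bsub>N\<^esub> n else \<zero>\<^bsub>N\<^esub>"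
  have g: "?g x \<in> carrier N" if "x \<in> T \<times> carrier N" for x
    using that N.smult_closed by auto
  note A = N.abelian_group_axioms
  show "clear N d (frag_of (t, n)) = (if d \<otimes> t \<in> D then (d \<otimes> t) \<odot>\<^bsub>N\<^esub> n else \<zero>\<^bsub>N\<^esub>)"
    if "t \<in> T" "n \<in> carrier N"
    unfolding clear_def using that by (subst additive_extension_of[OF A g]) auto
  show "Poly_Mapping.keys a \<subseteq> T \<times> carrier N \<Longrightarrow> clear N d a \<in> carrier N"
    unfolding clear_def by (rule additive_extension_closed[OF A g])
  show "clear N d 0 = \<zero>\<^bsub>N\<^esub>"
    unfolding clear_def by (rule additive_extension_zero[OF A g])
  show "\<lbrakk>Poly_Mapping.keys a \<subseteq> T \<times> carrier N; Poly_Mapping.keys b \<subseteq> T \<times> carrier N\<rbrakk> \<Longrightarrow>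
      clear N d (a - b) = clear N d a \<ominus>\<^bsub>N\<^esub> clear N d b"
    unfolding clear_def by (rule additive_extension_diff[OF A g])
qed

text \<open>Each defining relation of the tensor product is respected once \<open>d\<close> is a denominator of the
  elements of \<open>T\<close> in it, and only finitely many relations are involved.\<close>

lemma clear_tensor_ker:
  assumes R: denominators_trivial and N: "module R N" and c: "c \<in> tensor_ker R M N"
  shows "\<exists>J. trivial_ext J \<and> (\<forall>d \<in> J. clear N d c = \<zero>\<^bsub>N\<^esub>)"
proof -
  interpret N: module R N by fact
  note dt = trivial_ext_denominators[OF R]
  from module_M N c show ?thesis
  proof (induction rule: tensor_ker_induct)
    case zero
    show ?case using clear_zero[OF N] trivial_ext_D by blast
  next
    case (diff a b)
    then obtain I J where IJ: "trivial_ext I" "trivial_ext J"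
      "\<forall>d \<in> I. clear N d a = \<zero>\<^bsub>N\<^esub>" "\<forall>d \<in> J. clear N d b = \<zero>\<^bsub>N\<^esub>" by blast
    have "\<forall>d \<in> I \<inter> J. clear N d (a - b) = \<zero>\<^bsub>N\<^esub>"
      using IJ(3,4) diff(1,2) by (simp add: clear_diff[OF N] N.minus_eq)
    then show ?case using trivial_ext_Int[OF IJ(1,2)] by blast
  next
    case (add_left x y n)
    then have x: "x \<in> T" "y \<in> T" by simp_all
    have "clear N d (frag_of (x \<oplus>\<^bsub>M\<^esub> y, n) - frag_of (x, n) - frag_of (y, n)) = \<zero>\<^bsub>N\<^esub>"
      if "d \<in> denominators x \<inter> denominators y" for d
    proof -
      have d: "d \<in> D" "d \<otimes> x \<in> D" "d \<otimes> y \<in> D" using that by (auto simp: denominators_def)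
      have "d \<otimes> (x \<oplus> y) = d \<otimes> x \<oplus> d \<otimes> y" using d(1) x by (simp add: r_distr)
      then have "clear N d (frag_of (x \<oplus> y, n)) = clear N d (frag_of (x, n)) \<oplus>\<^bsub>N\<^esub> clear N d (frag_of (y, n))"
        using d x add_left N.smult_l_distr[of "d \<otimes> x" "d \<otimes> y" n] by (simp add: clear_of[OF N])
      then show ?thesis
        using x add_left clear_closed[OF N, of "frag_of (x, n)" d] clear_closed[OF N, of "frag_of (y, n)" d]
        by (simp add: clear_diff[OF N] keys_diff_subset N.add_minus_minus)
    qed
    then show ?case using trivial_ext_Int[OF dt[OF x(1)] dt[OF x(2)]] by blast
  next
    case (add_right x n p)
    then have x: "x \<in> T" by simp
    have "clear N d (frag_of (x, n \<oplus>\<^bsub>N\<^esub> p) - frag_of (x, n) - frag_of (x, p)) = \<zero>\<^bsub>N\<^esub>"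
      if "d \<in> denominators x" for d
    proof -
      have d: "d \<in> D" "d \<otimes> x \<in> D" using that by (auto simp: denominators_def)
      have "clear N d (frag_of (x, n \<oplus>\<^bsub>N\<^esub> p)) = clear N d (frag_of (x, n)) \<oplus>\<^bsub>N\<^esub> clear N d (frag_of (x, p))"
        using d x add_right N.smult_r_distr[of "d \<otimes> x" n p] by (simp add: clear_of[OF N])
      then show ?thesis
        using x add_right clear_closed[OF N, of "frag_of (x, n)" d] clear_closed[OF N, of "frag_of (x, p)" d]
        by (simp add: clear_diff[OF N] keys_diff_subset N.add_minus_minus)
    qed
    then show ?case using dt[OF x] by blast
  next
    case (smult r x n)
    then have x: "x \<in> T" "r \<in> D" "r \<in> T" "n \<in> carrier N" using D_T by simp_all
    have rn: "r \<odot>\<^bsub>N\<^esub> n \<in> carrier N" using x N.smult_closed[of r n] by simp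
    have "clear N d (frag_of (r \<odot>\<^bsub>M\<^esub> x, n) - frag_of (x, r \<odot>\<^bsub>N\<^esub> n)) = \<zero>\<^bsub>N\<^esub>"
      if "d \<in> denominators x" for d
    proof -
      have d: "d \<in> D" "d \<otimes> x \<in> D" using that by (auto simp: denominators_def)
      have e: "d \<otimes> (r \<otimes> x) = (d \<otimes> x) \<otimes> r" using d(1) x by (simp add: m_ac)
      have "clear N d (frag_of (r \<otimes> x, n)) = clear N d (frag_of (x, r \<odot>\<^bsub>N\<^esub> n))"
        using d x rn e N.smult_assoc1[of "d \<otimes> x" r n] by (simp add: clear_of[OF N])
      then show ?thesis
        using x rn clear_closed[OF N, of "frag_of (x, r \<odot>\<^bsub>N\<^esub> n)" d]
        by (simp add: clear_diff[OF N] N.minus_eq N.r_neg)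
    qed
    then show ?case using dt[OF x(1)] by blast
  qed
qed

text \<open>For a generator, \<open>d t \<otimes> n = 1 \<otimes> (d t) n\<close> if \<open>d t \<in> D\<close>; finitely many generators have a
  common ideal of denominators.\<close>

lemma scale_eq_clear:
  assumes R: denominators_trivial and N: "module R N" and c: "Poly_Mapping.keys c \<subseteq> T \<times> carrier N"
  shows "\<exists>J. trivial_ext J \<and> (\<forall>d \<in> J. scale d c - frag_of (\<one>, clear N d c) \<in> tensor_ker R M N)"
proof -
  interpret N: module R N by fact
  note add = tensor_ker_add_right[of \<one> M _ N _ R, simplified]
  from c show ?thesis
  proof (induction c rule: free_Abelian_group_induct[consumes 1, case_names zero diff of])
    case zero
    have "- frag_of (\<one>, \<zero>\<^bsub>N\<^esub>) \<in> tensor_ker R M N" using add[of "\<zero>\<^bsub>N\<^esub>" "\<zero>\<^bsub>N\<^esub>"] by simp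
    then show ?case using trivial_ext_D clear_zero[OF N] by auto
  next
    case (diff a b)
    then obtain I J where IJ: "trivial_ext I" "trivial_ext J"
      "\<forall>d \<in> I. scale d a - frag_of (\<one>, clear N d a) \<in> tensor_ker R M N"
      "\<forall>d \<in> J. scale d b - frag_of (\<one>, clear N d b) \<in> tensor_ker R M N" by blast
    have "scale d (a - b) - frag_of (\<one>, clear N d (a - b)) \<in> tensor_ker R M N" if "d \<in> I \<inter> J" for d
    proof -
      let ?x = "clear N d a" and ?y = "clear N d b"
      have xy: "?x \<in> carrier N" "?y \<in> carrier N" using diff clear_closed[OF N] by blast+
      have "(?x \<ominus>\<^bsub>N\<^esub> ?y) \<oplus>\<^bsub>N\<^esub> ?y = ?x" using xy by (simp add: N.minus_eq N.a_assoc N.l_neg)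
      then have 3: "frag_of (\<one>, ?x) - frag_of (\<one>, ?x \<ominus>\<^bsub>N\<^esub> ?y) - frag_of (\<one>, ?y) \<in> tensor_ker R M N"
        using add[of "?x \<ominus>\<^bsub>N\<^esub> ?y" ?y] xy by simp
      have 4: "(scale d a - frag_of (\<one>, ?x)) - (scale d b - frag_of (\<one>, ?y)) \<in> tensor_ker R M N"
        by (rule tensor_ker_diff[OF module_M N]) (use IJ(3,4) that in auto)
      show ?thesis
        using tensor_ker_add[OF 3 4] diff by (simp add: clear_diff[OF N] algebra_simps)
    qed
    then show ?case using trivial_ext_Int[OF IJ(1,2)] by blast
  next
    case (of x)
    then obtain t n where x: "x = (t, n)" "t \<in> T" "n \<in> carrier N" by auto
    have "scale d (frag_of x) - frag_of (\<one>, clear N d (frag_of x)) \<in> tensor_ker R M N"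
      if "d \<in> denominators t" for d
    proof -
      have d: "d \<in> D" "d \<otimes> t \<in> D" using that by (auto simp: denominators_def)
      then show ?thesis
        using x tensor_ker_smult[of "d \<otimes> t" R \<one> M n N] by (simp add: clear_of[OF N])
    qed
    then show ?case using trivial_ext_denominators[OF R x(2)] by blast
  qed
qed

lemma clear_natural:
  assumes N: "module R N" and N': "module R N'" and f: "f \<in> module_hom R N N'"
    and c: "Poly_Mapping.keys c \<subseteq> T \<times> carrier N"
  shows "clear N' d (frag_extend (\<lambda>(t, n). frag_of (t, f n)) c) = f (clear N d c)"
proof -
  interpret N: module R N by fact
  interpret N': module R N' by fact
  have fc: "f n \<in> carrier N'" if "n \<in> carrier N" for n using f that by (auto simp: module_hom_def)
  interpret f: group_hom "add_monoid N" "add_monoid N'" f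
    using f by unfold_locales (auto simp: module_hom_def hom_def)
  have f0: "f \<zero>\<^bsub>N\<^esub> = \<zero>\<^bsub>N'\<^esub>" using f.hom_one by simp
  have fd: "f (x \<ominus>\<^bsub>N\<^esub> y) = f x \<ominus>\<^bsub>N'\<^esub> f y" if "x \<in> carrier N" "y \<in> carrier N" for x y
    using f.hom_mult[of x "\<ominus>\<^bsub>N\<^esub> y"] f.hom_inv[of y] that
    by (simp add: N.minus_eq N'.minus_eq a_inv_def[symmetric])
  from c show ?thesis
  proof (induction c rule: free_Abelian_group_induct[consumes 1, case_names zero diff of])
    case zero
    show ?case using f0 clear_zero[OF N] clear_zero[OF N'] by simp
  next
    case (diff a b)
    then show ?case
      using frag_extend_module_hom_keys[OF f, of a M] frag_extend_module_hom_keys[OF f, of b M]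
      by (simp add: frag_extend_diff clear_diff[OF N] clear_diff[OF N'] fd clear_closed[OF N])
  next
    case (of x)
    then show ?case using f fc by (auto simp: clear_of[OF N] clear_of[OF N'] f0 module_hom_def)
  qed
qed

lemma flat_if_denominators_trivial:
  assumes R: denominators_trivial
  shows "flat TYPE('n) R M"
  unfolding flat_def
proof (intro conjI module_M allI impI; elim conjE)
  fix N N' :: "('a, 'n) module" and f
  assume N: "module R N" and N': "module R N'" and f: "f \<in> module_hom R N N'" and inj: "inj_on f (carrier N)"
  interpret N: module R N by fact
  interpret N': module R N' by fact
  show "inj_on (tensor_map R M N' f) (carrier (tensor R M N))"
    unfolding inj_tensor_map_iff[OF module_M N N' f]
  proof (intro allI impI)
    fix c :: "'a \<times> 'n \<Rightarrow>\<^sub>0 int"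
    assume "Poly_Mapping.keys c \<subseteq> carrier M \<times> carrier N"
    then have c: "Poly_Mapping.keys c \<subseteq> T \<times> carrier N" by simp
    assume "frag_extend (\<lambda>(m, n). frag_of (m, f n)) c \<in> tensor_ker R M N'"
    from clear_tensor_ker[OF R N' this] clear_natural[OF N N' f c]
    obtain I where I: "trivial_ext I" "\<And>d. d \<in> I \<Longrightarrow> f (clear N d c) = \<zero>\<^bsub>N'\<^esub>" by auto
    obtain J where J: "trivial_ext J"
      "\<And>d. d \<in> J \<Longrightarrow> scale d c - frag_of (\<one>, clear N d c) \<in> tensor_ker R M N"
      using scale_eq_clear[OF R N c] by blast
    have f0: "f \<zero>\<^bsub>N\<^esub> = \<zero>\<^bsub>N'\<^esub>"
      using clear_natural[OF N N' f, of 0 \<zero>] by (simp add: clear_zero[OF N] clear_zero[OF N'])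
    have zero: "frag_of (\<one>, \<zero>\<^bsub>N\<^esub>) \<in> tensor_ker R M N"
      using tensor_ker_minus[OF module_M N tensor_ker_add_right[of \<one> M "\<zero>\<^bsub>N\<^esub>" N "\<zero>\<^bsub>N\<^esub>" R]]
      by simp
    show "c \<in> tensor_ker R M N"
    proof (rule tensor_ker_if_scale[OF N c trivial_ext_Int[OF I(1) J(1)]])
      fix d assume d: "d \<in> I \<inter> J"
      then have "clear N d c = \<zero>\<^bsub>N\<^esub>"
        using inj_onD[OF inj, of "clear N d c" "\<zero>\<^bsub>N\<^esub>"] I(2) f0 clear_closed[OF N c] by simp
      then show "scale d c \<in> tensor_ker R M N" using tensor_ker_cancel[OF _ zero] J(2)[of d] d by simp
    qed
  qed
qed

end

theorem proposition3p1:
  fixes K :: "('a, 'b) ring_scheme" and D T :: "'a set"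
  assumes "quotient_field D K"
    and "T \<in> Overr D K"
  shows "stable D K (\<iota> D K T) \<longleftrightarrow> flat TYPE('a + 'u) (K\<lparr>carrier := D\<rparr>) (as_module K T)"
proof -
  interpret overring K D T
    using assms by (simp add: overring_def overring_axioms_def quotient_field_def)
  show ?thesis
    unfolding stable_iff_denominators_trivial
    using flat_if_denominators_trivial denominators_trivial_if_flat by blast
qed

end
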